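(* (i) For $n=1$, $\mathfrak{B}_n$ has exactly one (trivial) $\mathcal{R}$-cross-section. (ii) For $n=2$, $\mathfrak{B}_n$ has exactly one $\mathcal{R}$-cross-section; it is canonical and consists of $\alpha_{1,2}$ and $\mathrm{id}$. (iii) For $n=3$, $\mathfrak{B}_n$ has exactly one canonical $\mathcal{R}$-cross-section, consisting of the idempotents $\alpha_{1,2},\alpha_{2,3},\alpha_{1,3}$ and $\mathrm{id}$. (iv) For $n=4$, $\mathfrak{B}_n$ has exactly $2$ canonical $\mathcal{R}$-cross-sections; for one of them $\alpha_{1,2}^{(1)}=\mathrm{id}$, for the other $\alpha_{1,2}^{(1)}=(1,2)$. (v) For $n=5$, $\mathfrak{B}_n$ has exactly $8$ canonical $\mathcal{R}$-cross-sections, which correspond (bijectively) to independent choices of the parameters $\alpha_{1,2}^{(1)},\alpha_{2,3}^{(1)},\alpha_{1,3}^{(1)}\in\mathcal{S}_2$. (vi) For $n=6$, $\mathfrak{B}_n$ has exactly $16$ canonical $\mathcal{R}$-cross-sections, which correspond (bijectively) to independent choices of the parameters $\alpha_{1,2}^{(1)},\alpha_{1,2}^{(2)},\alpha_{2,3}^{(1)},\alpha_{1,3}^{(1)}\in\mathcal{S}_2$.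
   Context: Let $M=\{1,\dots,n\}$, $M'=\{1',\dots,n'\}$. The Brauer semigroup $\mathfrak{B}_n$ is the set of all partitions of $M\cup M'$ into two-element subsets; write $a\equiv_\alpha b$ if $\{a,b\}\in\alpha$. The product $\alpha\beta$ is obtained by drawing $\alpha$ to the left of $\beta$ ($M$ = left pins, $M'$ = right pins), identifying each right pin $a'$ of $\alpha$ with the left pin $a$ of $\beta$, pairing the left pins of $\alpha$ and right pins of $\beta$ that are joined by a path, and discarding closed loops. $\mathfrak{B}_n$ is a monoid. $\mathrm{corank}(\alpha)$ is $n$ minus the number of blocks of the form $\{a,b'\}$, $a,b\in M$; it is even. Green's relation: $\alpha\mathcal{R}\beta$ iff $\alpha,\beta$ contain the same two-element subsets of $M$. An $\mathcal{R}$-cross-section is a subsemigroup containing exactly one element of each $\mathcal{R}$-class. An $\mathcal{R}$-cross-section $\Lambda$ is canonical if every $\alpha\in\Lambda$ of corank $2k$ satisfies $(n-2k+1)'\equiv_\alpha(n-2k+2)'$, $(n-2k+3)'\equiv_\alpha(n-2k+4)'$, ..., $(n-1)'\equiv_\alpha n'$. For a canonical $\Lambda$ and $1\le i<j\le n$, $\alpha_{i,j}$ denotes the unique element of $\Lambda$ of corank $2$ with $i\equiv_{\alpha_{i,j}}j$. For $1\le i<j<n-1$ and $l=1,\dots,\lfloor\frac{n-j}{2}\rfloor$, define $\alpha_{i,j}^{(l)}\in\mathcal{S}_2$ to be $\mathrm{id}$ if $(n-2l+2)\equiv_{\alpha_{i,j}}(n-2l)'$ and $(1,2)$ if $(n-2l+2)\equiv_{\alpha_{i,j}}(n-2l-1)'$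 (exactly one of the two always holds). *)

theory Defs
  imports "HOL-Library.Disjoint_Sets" "HOL-Combinatorics.Permutations"
begin

(* The left pin a is Inl a, the right pin a' is Inr a. *)
type_synonym pin = "nat + nat"

definition pins :: "nat \<Rightarrow> pin set" where
  "pins n = {1..n} <+> {1..n}"

definition brauer :: "nat \<Rightarrow> pin set set set" where
  "brauer n = {\<alpha>. partition_on (pins n) \<alpha> \<and> (\<forall>B\<in>\<alpha>. card B = 2)}"

definition brauer_one :: "nat \<Rightarrow> pin set set" where
  "brauer_one n = {{Inl a, Inr a} |a. a \<in> {1..n}}"

(* The vertices of the picture of a product: Mid a is the right pin a' of the left factor
   identified with the left pin a of the right factor. *)
datatype vertex = Lft nat | Mid nat | Rgt nat

(* Symmetric, so its reflexive transitive closure is "joined by a path". *)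
definition glued_edges :: "pin set set \<Rightarrow> pin set set \<Rightarrow> (vertex \<times> vertex) set" where
  "glued_edges \<alpha> \<beta> =
     {(u, v). (\<exists>B\<in>\<alpha>. {u, v} = case_sum Lft Mid ` B) \<or> (\<exists>B\<in>\<beta>. {u, v} = case_sum Mid Rgt ` B)}"

definition brauer_mult :: "nat \<Rightarrow> pin set set \<Rightarrow> pin set set \<Rightarrow> pin set set" where
  "brauer_mult n \<alpha> \<beta> =
     {{p, q} |p q. p \<in> pins n \<and> q \<in> pins n \<and> p \<noteq> q \<and>
        (case_sum Lft Rgt p, case_sum Lft Rgt q) \<in> (glued_edges \<alpha> \<beta>)\<^sup>*}"

definition corank :: "nat \<Rightarrow> pin set set \<Rightarrow> nat" where
  "corank n \<alpha> = n - card {B \<in> \<alpha>. \<exists>a\<in>{1..n}. \<exists>b\<in>{1..n}. B = {Inl a, Inr b}}"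

definition green_R :: "nat \<Rightarrow> (pin set set \<times> pin set set) set" where
  "green_R n = {(\<alpha>, \<beta>). \<alpha> \<in> brauer n \<and> \<beta> \<in> brauer n \<and>
     {B \<in> \<alpha>. B \<subseteq> Inl ` {1..n}} = {B \<in> \<beta>. B \<subseteq> Inl ` {1..n}}}"

definition R_cross_section :: "nat \<Rightarrow> pin set set set \<Rightarrow> bool" where
  "R_cross_section n \<Lambda> \<longleftrightarrow>
     \<Lambda> \<subseteq> brauer n \<and>
     (\<forall>\<alpha>\<in>\<Lambda>. \<forall>\<beta>\<in>\<Lambda>. brauer_mult n \<alpha> \<beta> \<in> \<Lambda>) \<and>
     (\<forall>C \<in> brauer n // green_R n. \<exists>!\<alpha>. \<alpha> \<in> \<Lambda> \<inter> C)"

definition canonical_R_cross_section :: "nat \<Rightarrow> pin set set set \<Rightarrow> bool" where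
  "canonical_R_cross_section n \<Lambda> \<longleftrightarrow>
     R_cross_section n \<Lambda> \<and>
     (\<forall>\<alpha>\<in>\<Lambda>. \<forall>k. corank n \<alpha> = 2 * k \<longrightarrow>
        (\<forall>m<k. {Inr (n - 2 * k + 2 * m + 1), Inr (n - 2 * k + 2 * m + 2)} \<in> \<alpha>))"

definition cs_elem :: "nat \<Rightarrow> pin set set set \<Rightarrow> nat \<Rightarrow> nat \<Rightarrow> pin set set" where
  "cs_elem n \<Lambda> i j = (THE \<alpha>. \<alpha> \<in> \<Lambda> \<and> corank n \<alpha> = 2 \<and> {Inl i, Inl j} \<in> \<alpha>)"

(* Meant for 1 <= i < j < n - 1 and 1 <= l <= (n - j) div 2; then no subtraction truncates. *)
definition cs_param :: "nat \<Rightarrow> pin set set set \<Rightarrow> nat \<Rightarrow> nat \<Rightarrow> nat \<Rightarrow> nat \<Rightarrow> nat" where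
  "cs_param n \<Lambda> i j l =
     (if {Inl (n - 2 * l + 2), Inr (n - 2 * l)} \<in> cs_elem n \<Lambda> i j then id
      else if {Inl (n - 2 * l + 2), Inr (n - 2 * l - 1)} \<in> cs_elem n \<Lambda> i j then transpose 1 2
      else undefined)"

definition S2 :: "(nat \<Rightarrow> nat) set" where
  "S2 = {\<pi>. \<pi> permutes {1, 2}}"

end

theory Submission
  imports Defs
begin

text \<open>A canonical cross-section contains one element of each class, so the product of two of its
  elements must itself be canonical and must agree with the element already known in its class.
  The elements of the classes of corank at least $n - 1$ and of corank $0$ are forced. Branching over
  the canonical elements in the classes of corank $2$ and propagating products of two of them in this
  way leaves exactly $1, 1, 1, 2, 8, 16$ tables for $n = 1, \dots, 6$, and every table meets all classes.
  Conversely, each table is closed under multiplication. The tables for one $n$ overlap heavily,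
  so each product is formed only once: every element is tagged with the tables that contain it,
  and the tags of a product must include the common tags of its factors.\<close>

section \<open>Elements as lists of partners\<close>

text \<open>Canonicity is what forces the extreme elements: in corank at least n - 1 the prescribed
  right blocks leave at most one right pin, and in corank 0 the representative is a permutation in
  the same class as its square. That the elements of corank 2 generate enough is observed on the
  finished tables rather than proved. For a given canonical cross-section \<Lambda>, some branch of
  the search stays inside \<Lambda>; once its table is seen to meet every class, uniqueness of
  representatives leaves \<Lambda> no further element. Products are computed by walks with bounded
  fuel. In place of a termination proof, a computed product is used only when it is seen to be a
  code, and the walk is shown correct under that condition. All evaluation is by
  \<open>code_simp\<close>, that is, by rewriting inside the logic. This cost is why the search
  multiplies only generators and why closure is checked once for all tables of one n.\<close>

text \<open>A code lists the partners of $1, \dots, n$ and of $1', \dots, n'$. Positions count from 1.\<close>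

type_synonym code = "pin list \<times> pin list"

fun at :: "'a list \<Rightarrow> nat \<Rightarrow> 'a" where
  "at (x # xs) (Suc 0) = x"
| "at (x # xs) (Suc (Suc n)) = at xs (Suc n)"

text \<open>The walk through the picture of a product that arrives at a pin of the left (right) factor.
  When the fuel runs out, it ends in \<^term>\<open>Inl 0 :: nat + nat\<close>, which is not a pin.\<close>

fun exitL :: "pin list \<Rightarrow> pin list \<Rightarrow> nat \<Rightarrow> pin \<Rightarrow> pin"
and exitR :: "pin list \<Rightarrow> pin list \<Rightarrow> nat \<Rightarrow> pin \<Rightarrow> pin" where
  "exitL R L k (Inl a) = Inl a"
| "exitL R L 0 (Inr a) = Inl 0"
| "exitL R L (Suc k) (Inr a) = exitR R L k (at L a)"
| "exitR R L k (Inr a) = Inr a"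
| "exitR R L 0 (Inl a) = Inl 0"
| "exitR R L (Suc k) (Inl a) = exitL R L k (at R a)"

text \<open>The fuel n suffices because a path from an outer pin meets each of the n middle pins at
  most once and a unit is spent at each of them. The proof relies on the test \<open>is_code\<close>
  of the product instead: a walk that ran out would leave \<open>Inl 0\<close>, which is not a
  pin.\<close>

definition code_mult :: "nat \<Rightarrow> code \<Rightarrow> code \<Rightarrow> code" where
  "code_mult n x y = (map (exitL (snd x) (fst y) n) (fst x), map (exitR (snd x) (fst y) n) (snd y))"

fun partner :: "code \<Rightarrow> pin \<Rightarrow> pin" where
  "partner c (Inl a) = at (fst c) a"
| "partner c (Inr a) = at (snd c) a"

fun is_pin :: "nat \<Rightarrow> pin \<Rightarrow> bool" where
  "is_pin n (Inl a) = (0 < a \<and> a \<le> n)"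
| "is_pin n (Inr a) = (0 < a \<and> a \<le> n)"

definition pin_list :: "nat \<Rightarrow> pin list" where
  "pin_list n = map Inl [1..<Suc n] @ map Inr [1..<Suc n]"

definition matched :: "nat \<Rightarrow> code \<Rightarrow> pin \<Rightarrow> bool" where
  "matched n c p \<longleftrightarrow> is_pin n (partner c p) \<and> partner c p \<noteq> p \<and> partner c (partner c p) = p"

definition is_code :: "nat \<Rightarrow> code \<Rightarrow> bool" where
  "is_code n c \<longleftrightarrow> length (fst c) = n \<and> length (snd c) = n \<and> list_all (matched n c) (pin_list n)"

fun left_of :: "pin \<Rightarrow> nat" where
  "left_of (Inl b) = b"
| "left_of (Inr b) = 0"

text \<open>The class of an element, with 0 for the left pins that are not in a left block.\<close>

definition lefts :: "code \<Rightarrow> nat list" where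
  "lefts c = map left_of (fst c)"

text \<open>The corank, read off the class: it counts the left pins that lie on no block crossing to
  the right side.\<close>

definition left_degree :: "nat list \<Rightarrow> nat" where
  "left_degree w = length (filter (\<lambda>b. b \<noteq> 0) w)"

text \<open>The smaller pins of the prescribed right blocks. An odd \<open>d\<close> imposes
  nothing, just as the definition of canonical speaks of corank 2k only.\<close>

definition tail_starts :: "nat \<Rightarrow> nat \<Rightarrow> nat list" where
  "tail_starts n d = (if even d then map (\<lambda>m. n - d + 2 * m + 1) [0..<d div 2] else [])"

definition canonical_code :: "nat \<Rightarrow> code \<Rightarrow> bool" where
  "canonical_code n c \<longleftrightarrow>
     list_all (\<lambda>b. at (snd c) b = Inr (b + 1)) (tail_starts n (left_degree (lefts c)))"

section \<open>Search for canonical cross-sections\<close>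

text \<open>Enumerates the involutions on a list; a pair \<open>(v, q)\<close> in the accumulator says that \<open>q\<close> is sent
  to \<open>v\<close>, hence \<open>v\<close> to \<open>q\<close>.\<close>

fun assignments :: "('a \<times> 'a) list \<Rightarrow> ('a \<Rightarrow> 'a list) \<Rightarrow> 'a list \<Rightarrow> 'a list list" where
  "assignments acc opts [] = [[]]"
| "assignments acc opts (p # ps) =
     (case map_of acc p of
        Some q \<Rightarrow> map (Cons q) (assignments acc opts ps)
      | None \<Rightarrow> concat (map (\<lambda>v. map (Cons v) (assignments ((v, p) # acc) opts ps))
                     (filter (\<lambda>v. v \<notin> set (map fst acc) \<and> v \<notin> set (map snd acc)) (opts p))))"

text \<open>A class is an involution of {1..n} whose fixed points are the pins outside left blocks;
  in the notation of \<open>lefts\<close> these carry 0.\<close>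

fun zero_fixpoints :: "nat \<Rightarrow> nat list \<Rightarrow> nat list" where
  "zero_fixpoints a [] = []"
| "zero_fixpoints a (b # bs) = (if a = b then 0 else b) # zero_fixpoints (Suc a) bs"

definition classes :: "nat \<Rightarrow> nat list list" where
  "classes n = map (zero_fixpoints 1) (assignments [] (\<lambda>a. [1..<Suc n]) [1..<Suc n])"

text \<open>Each pair appears in both orientations. \<open>assignments\<close> looks a point up
  among the first components only, and a point that occurred just as a second component would be
  given a new value when its turn comes. For left blocks both orientations arise because
  \<open>a\<close> runs over both ends.\<close>

definition forced :: "nat \<Rightarrow> nat list \<Rightarrow> (pin \<times> pin) list" where
  "forced n w =
     map (\<lambda>a. (Inl (at w a), Inl a)) (filter (\<lambda>a. at w a \<noteq> 0) [1..<Suc n]) @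
     concat (map (\<lambda>b. [(Inr b, Inr (b + 1)), (Inr (b + 1), Inr b)]) (tail_starts n (left_degree w)))"

definition split_code :: "nat \<Rightarrow> pin list \<Rightarrow> code" where
  "split_code n l = (take n l, drop n l)"

text \<open>The left blocks are already in \<open>forced\<close>, so a remaining left pin may only
  go to the right. \<open>assignments\<close> admits fixed points, which \<open>classes\<close>
  depends on; here the test \<open>is_code\<close> removes them.\<close>

definition cands :: "nat \<Rightarrow> nat list \<Rightarrow> code list" where
  "cands n w = filter (\<lambda>c. is_code n c \<and> lefts c = w \<and> canonical_code n c) (map (split_code n)
     (assignments (forced n w) (case_sum (\<lambda>a. map Inr [1..<Suc n]) (\<lambda>b. pin_list n)) (pin_list n)))"

type_synonym tab = "(nat list \<times> code) list"

text \<open>Here and below, the outcome of a test is passed on as an argument instead of branching with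
  \<open>if\<close> or \<open>case\<close>: rewriting with these equations stops early, and it does not normalise the large
  tables again after each test.\<close>

fun same :: "bool \<Rightarrow> 'a list \<Rightarrow> 'a list \<Rightarrow> bool" where
  "same False xs ys = False"
| "same True [] [] = True"
| "same True [] (y # ys) = False"
| "same True (x # xs) [] = False"
| "same True (x # xs) (y # ys) = same (x = y) xs ys"

fun guard :: "bool \<Rightarrow> 'b \<Rightarrow> 'b option" where
  "guard True v = Some v"
| "guard False v = None"

fun lookup_from :: "'b option \<Rightarrow> ('a list \<times> 'b) list \<Rightarrow> 'a list \<Rightarrow> 'b option" where
  "lookup_from (Some v) ps k = Some v"
| "lookup_from None [] k = None"
| "lookup_from None ((l, v) # ps) k = lookup_from (guard (same True l k) v) ps k"

definition lookup :: "('a list \<times> 'b) list \<Rightarrow> 'a list \<Rightarrow> 'b option" where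
  "lookup = lookup_from None"

fun same_code :: "code \<Rightarrow> code \<Rightarrow> bool" where
  "same_code (L, R) (L', R') = same True (L @ R) (L' @ R')"

text \<open>A second code in an occupied class refutes the branch. A \<open>z\<close> that is not a
  code carries no information, so the table stays as it is; this keeps the search sound whatever the
  walk returns.\<close>

fun insert_old :: "nat \<Rightarrow> code \<Rightarrow> tab \<Rightarrow> bool \<Rightarrow> tab option" where
  "insert_old n z D True = Some D"
| "insert_old n z D False = (if is_code n z then None else Some D)"

fun insert_new :: "nat \<Rightarrow> code \<Rightarrow> tab \<Rightarrow> bool \<Rightarrow> tab option" where
  "insert_new n z D True = (if canonical_code n z then Some ((lefts z, z) # D) else None)"
| "insert_new n z D False = Some D"

fun insert_found :: "nat \<Rightarrow> code \<Rightarrow> tab \<Rightarrow> code option \<Rightarrow> tab option" where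
  "insert_found n z D (Some w) = insert_old n z D (same_code w z)"
| "insert_found n z D None = insert_new n z D (is_code n z)"

definition insert_code :: "nat \<Rightarrow> code \<Rightarrow> tab \<Rightarrow> tab option" where
  "insert_code n z D = insert_found n z D (lookup D (lefts z))"

fun insert_product :: "nat \<Rightarrow> code \<Rightarrow> code \<Rightarrow> tab option \<Rightarrow> tab option" where
  "insert_product n x y None = None"
| "insert_product n x y (Some D) = insert_code n (code_mult n x y) D"

fun add_products :: "nat \<Rightarrow> code \<Rightarrow> code list \<Rightarrow> tab option \<Rightarrow> tab option" where
  "add_products n x [] D = D"
| "add_products n x (y # ys) D =
     add_products n x ys (insert_product n y x (insert_product n x y D))"

text \<open>\<open>G\<close> holds the generators chosen so far. Only products of two generators are
  formed here; whether the outcome is closed and meets all classes is decided afterwards by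
  \<open>closed_tabs\<close> and \<open>all_cover\<close>.\<close>

definition add_code :: "nat \<Rightarrow> code \<Rightarrow> code list \<Rightarrow> tab \<Rightarrow> tab option" where
  "add_code n x G D = add_products n x (x # G) (insert_code n x D)"

fun branch :: "code list \<Rightarrow> code \<Rightarrow> tab option \<Rightarrow> (code list \<times> tab) list" where
  "branch G x None = []"
| "branch G x (Some D) = [(x # G, D)]"

fun step1 :: "nat \<Rightarrow> code list \<Rightarrow> tab \<Rightarrow> code list \<Rightarrow> (code list \<times> tab) list" where
  "step1 n G D [] = []"
| "step1 n G D (x # xs) = branch G x (add_code n x G D) @ step1 n G D xs"

fun step :: "nat \<Rightarrow> code list \<Rightarrow> (code list \<times> tab) list \<Rightarrow> (code list \<times> tab) list" where
  "step n xs [] = []"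
| "step n xs ((G, D) # S) = step1 n G D xs @ step n xs S"

fun search :: "nat \<Rightarrow> nat list list \<Rightarrow> (code list \<times> tab) list \<Rightarrow> (code list \<times> tab) list" where
  "search n [] S = S"
| "search n (w # ws) S = search n ws (step n (cands n w) S)"

fun seeds1 :: "nat list \<Rightarrow> code list \<Rightarrow> tab" where
  "seeds1 w [c] = [(w, c)]" | "seeds1 w _ = []"

fun seeds :: "nat \<Rightarrow> nat list list \<Rightarrow> tab" where
  "seeds n [] = []"
| "seeds n (w # ws) = seeds1 w (cands n w) @ seeds n ws"

text \<open>The second inequality selects corank n or n - 1, where the prescribed right blocks leave
  no choice. The first one keeps out the class of the identity, which for n = 1 would satisfy the
  second. \<open>seeds1\<close> keeps a class only if its candidate really is unique, so soundness
  does not rest on this count.\<close>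

definition seed :: "nat \<Rightarrow> tab" where
  "seed n = (replicate n 0, (map Inr [1..<Suc n], map Inl [1..<Suc n])) #
     seeds n (filter (\<lambda>w. 2 \<le> left_degree w \<and> n \<le> left_degree w + 1) (classes n))"

definition pair_class :: "nat \<Rightarrow> nat \<times> nat \<Rightarrow> nat list" where
  "pair_class n ij = map (\<lambda>a. if a = fst ij then snd ij else if a = snd ij then fst ij else 0) [1..<Suc n]"

fun sections :: "(code list \<times> tab) list \<Rightarrow> tab list" where
  "sections [] = []"
| "sections ((G, D) # S) = D # sections S"

text \<open>The order of branching. The pairs with j < n - 1, to which the parameters belong, come
  last, when the tables already hold the products of all the other generators.\<close>

definition corank_pairs :: "nat \<Rightarrow> (nat \<times> nat) list" where
  "corank_pairs n = (if n < 2 then [] else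
     (n - 1, n) # map (\<lambda>i. (i, n - 1)) [1..<n - 1] @ map (\<lambda>i. (i, n)) [1..<n - 1] @
     concat (map (\<lambda>j. map (\<lambda>i. (i, j)) [1..<j]) [2..<n - 1]))"

definition found :: "nat \<Rightarrow> tab list" where
  "found n = sections (search n (map (pair_class n) (corank_pairs n)) [([], seed n)])"

section \<open>Simultaneous check of closure\<close>

fun has :: "code \<Rightarrow> code option \<Rightarrow> bool" where
  "has c None = False"
| "has c (Some d) = same_code c d"

fun tag :: "tab list \<Rightarrow> code \<Rightarrow> bool list" where
  "tag [] c = []"
| "tag (D # Ds) c = has c (lookup D (lefts c)) # tag Ds c"

type_synonym tagged = "(pin list \<times> code \<times> bool list) list"

fun tag_insert :: "tab list \<Rightarrow> tagged \<Rightarrow> code \<Rightarrow> (code \<times> bool list) option \<Rightarrow> tagged" where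
  "tag_insert S U c None = (fst c @ snd c, c, tag S c) # U"
| "tag_insert S U c (Some v) = U"

fun tag_codes :: "tab list \<Rightarrow> tagged \<Rightarrow> tab \<Rightarrow> tagged" where
  "tag_codes S U [] = U"
| "tag_codes S U ((w, c) # D) = tag_codes S (tag_insert S U c (lookup U (fst c @ snd c))) D"

fun meet_empty :: "bool list \<Rightarrow> bool list \<Rightarrow> bool" where
  "meet_empty (True # as) (True # bs) = False"
| "meet_empty (a # as) (b # bs) = meet_empty as bs"
| "meet_empty as bs = True"

fun meet_le :: "bool list \<Rightarrow> bool list \<Rightarrow> bool list \<Rightarrow> bool" where
  "meet_le (True # as) (True # bs) (False # cs) = False"
| "meet_le (a # as) (b # bs) (c # cs) = meet_le as bs cs"
| "meet_le as bs cs = True"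

fun check_mask :: "bool list \<Rightarrow> bool list \<Rightarrow> (code \<times> bool list) option \<Rightarrow> bool" where
  "check_mask a b None = False"
| "check_mask a b (Some (z, c)) = meet_le a b c"

fun check_code :: "tagged \<Rightarrow> bool list \<Rightarrow> bool list \<Rightarrow> code \<Rightarrow> bool" where
  "check_code U a b (L, R) = check_mask a b (lookup U (L @ R))"

fun check_pair :: "nat \<Rightarrow> tagged \<Rightarrow> code \<Rightarrow> bool list \<Rightarrow> code \<Rightarrow> bool list \<Rightarrow> bool \<Rightarrow> bool" where
  "check_pair n U x a y b True = True"
| "check_pair n U x a y b False = check_code U a b (code_mult n x y)"

fun closed_row :: "nat \<Rightarrow> tagged \<Rightarrow> code \<Rightarrow> bool list \<Rightarrow> bool \<Rightarrow> tagged \<Rightarrow> bool" where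
  "closed_row n U x a False V = False"
| "closed_row n U x a True [] = True"
| "closed_row n U x a True ((k, y, b) # V) =
     closed_row n U x a (check_pair n U x a y b (meet_empty a b)) V"

fun closed_rows :: "nat \<Rightarrow> tagged \<Rightarrow> bool \<Rightarrow> tagged \<Rightarrow> bool" where
  "closed_rows n U False V = False"
| "closed_rows n U True [] = True"
| "closed_rows n U True ((k, x, a) # V) = closed_rows n U (closed_row n U x a True U) V"

definition closed_tagged :: "nat \<Rightarrow> tagged \<Rightarrow> bool" where
  "closed_tagged n U = closed_rows n U True U"

definition closed_tabs :: "nat \<Rightarrow> tab list \<Rightarrow> bool" where
  "closed_tabs n S = closed_tagged n (tag_codes S [] (concat S))"

fun is_some :: "'a option \<Rightarrow> bool" where
  "is_some None = False"
| "is_some (Some v) = True"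

fun covers :: "tab \<Rightarrow> bool \<Rightarrow> nat list list \<Rightarrow> bool" where
  "covers D False ws = False"
| "covers D True [] = True"
| "covers D True (w # ws) = covers D (is_some (lookup D w)) ws"

fun all_cover :: "nat list list \<Rightarrow> tab list \<Rightarrow> bool" where
  "all_cover ws [] = True"
| "all_cover ws (D # S) = (covers D True ws \<and> all_cover ws S)"

text \<open>\<^term>\<open>True\<close> stands for the transposition.\<close>

fun param_of :: "nat \<Rightarrow> nat \<Rightarrow> code option \<Rightarrow> bool option" where
  "param_of n l None = None"
| "param_of n l (Some c) = (if at (fst c) (n - 2 * l + 2) = Inr (n - 2 * l) then Some False
     else if at (fst c) (n - 2 * l + 2) = Inr (n - 2 * l - 1) then Some True else None)"

fun profile :: "nat \<Rightarrow> (nat \<times> nat \<times> nat) list \<Rightarrow> tab \<Rightarrow> bool option list" where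
  "profile n [] D = []"
| "profile n ((i, j, l) # ps) D = param_of n l (lookup D (pair_class n (i, j))) # profile n ps D"

text \<open>Coverage, closure and parameters are gathered in one term, so that for n = 4, 5, 6 a
  single evaluation of the search yields all of them. The classes of corank 2 are covered explicitly
  because the completeness of the search presupposes that they are inhabited.\<close>

definition report :: "nat \<Rightarrow> (nat \<times> nat \<times> nat) list \<Rightarrow> tab list \<Rightarrow> bool \<times> bool option list list" where
  "report n ps S =
     (all_cover (classes n @ map (pair_class n) (corank_pairs n)) S \<and> closed_tabs n S, map (profile n ps) S)"

section \<open>Correctness of the product\<close>

definition pairing :: "nat \<Rightarrow> (pin \<Rightarrow> pin) \<Rightarrow> bool" where
  "pairing n f \<longleftrightarrow> (\<forall>p\<in>pins n. f p \<in> pins n \<and> f p \<noteq> p \<and> f (f p) = p)"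

definition blocks :: "nat \<Rightarrow> (pin \<Rightarrow> pin) \<Rightarrow> pin set set" where
  "blocks n f = (\<lambda>p. {p, f p}) ` pins n"

lemma pairingD:
  assumes "pairing n f" "p \<in> pins n"
  shows "f p \<in> pins n" "f p \<noteq> p" "f (f p) = p"
  using assms unfolding pairing_def by auto

lemma block_mem_iff:
  assumes "pairing n f" "p \<in> pins n"
  shows "{p, q} \<in> blocks n f \<longleftrightarrow> q = f p"
  using assms unfolding blocks_def by (auto simp: doubleton_eq_iff pairingD)

lemma blocks_brauer:
  assumes "pairing n f"
  shows "blocks n f \<in> brauer n"
proof -
  have "partition_on (pins n) (blocks n f)"
  proof (rule partition_onI)
    show "\<Union> (blocks n f) = pins n"
      using assms unfolding blocks_def by (auto simp: pairingD)
  next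
    fix B C assume "B \<in> blocks n f" "C \<in> blocks n f" "B \<noteq> C"
    then obtain p q where "p \<in> pins n" "q \<in> pins n" "B = {p, f p}" "C = {q, f q}" "B \<noteq> C"
      by (auto simp: blocks_def)
    moreover from this have "f (f p) = p" "f (f q) = q"
      using assms by (simp_all add: pairing_def)
    ultimately show "disjnt B C"
      unfolding disjnt_def by (metis disjoint_insert(1) doubleton_eq_iff inf_bot_right insertE singletonD)
  qed (auto simp: blocks_def)
  moreover have "\<forall>B\<in>blocks n f. card B = 2"
    unfolding blocks_def using pairingD(2)[OF assms] by (fastforce simp: card_insert_if)
  ultimately show ?thesis
    by (simp add: brauer_def)
qed

lemma brauer_blocksE:
  assumes "\<alpha> \<in> brauer n"
  obtains f where "pairing n f" "\<alpha> = blocks n f"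
proof -
  have part: "partition_on (pins n) \<alpha>" and two: "\<And>B. B \<in> \<alpha> \<Longrightarrow> card B = 2"
    using assms by (auto simp: brauer_def)
  have ex: "\<exists>q. q \<noteq> p \<and> {p, q} \<in> \<alpha>" if "p \<in> pins n" for p
  proof -
    obtain B where B: "B \<in> \<alpha>" "p \<in> B"
      using \<open>p \<in> pins n\<close> partition_onD1[OF part] by blast
    then obtain u v where uv: "B = {u, v}" "u \<noteq> v"
      using two[OF B(1)] by (auto simp: card_2_iff)
    then show ?thesis
      using B by (metis insertE insert_commute singletonD)
  qed
  define f where "f p = (SOME q. q \<noteq> p \<and> {p, q} \<in> \<alpha>)" for p
  have f: "f p \<noteq> p" "{p, f p} \<in> \<alpha>" if "p \<in> pins n" for p
    using someI_ex[OF ex[OF that]] by (auto simp: f_def)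
  have same: "B = C" if "B \<in> \<alpha>" "C \<in> \<alpha>" "p \<in> B" "p \<in> C" for B C p
    using that partition_onD2[OF part] unfolding disjoint_def by blast
  have mem: "f p \<in> pins n" if "p \<in> pins n" for p
    using f(2)[OF that] partition_onD1[OF part] by blast
  have "pairing n f"
    unfolding pairing_def
  proof (intro ballI conjI)
    fix p assume p: "p \<in> pins n"
    have "{p, f p} = {f p, f (f p)}"
      using same[OF f(2)[OF p] f(2)[OF mem[OF p]], of "f p"] by simp
    then show "f (f p) = p"
      using f(1)[OF p] by (auto simp: doubleton_eq_iff)
  qed (use f mem in auto)
  moreover have "\<alpha> = blocks n f"
  proof
    show "blocks n f \<subseteq> \<alpha>"
      using f(2) by (auto simp: blocks_def)
    show "\<alpha> \<subseteq> blocks n f"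
    proof
      fix B assume B: "B \<in> \<alpha>"
      then obtain p where "p \<in> B"
        using two by fastforce
      then have "p \<in> pins n" "B = {p, f p}"
        using B partition_onD1[OF part] same[OF B f(2), of p p] by auto
      then show "B \<in> blocks n f"
        by (auto simp: blocks_def)
    qed
  qed
  ultimately show thesis
    using that by blast
qed

definition dec :: "nat \<Rightarrow> code \<Rightarrow> pin set set" where
  "dec n c = blocks n (partner c)"

lemma at_Suc: "i < length xs \<Longrightarrow> at xs (Suc i) = xs ! i"
proof (induction xs arbitrary: i)
  case (Cons x xs)
  then show ?case by (cases i) auto
qed simp

lemma at_eq_nth: "1 \<le> a \<Longrightarrow> a \<le> length xs \<Longrightarrow> at xs a = xs ! (a - 1)"
  using at_Suc[of "a - 1" xs] by simp

lemma at_map: "1 \<le> a \<Longrightarrow> a \<le> length xs \<Longrightarrow> at (map f xs) a = f (at xs a)"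
  by (simp add: at_eq_nth)

lemma set_pin_list: "set (pin_list n) = pins n"
  by (auto simp: pin_list_def pins_def Plus_def)

lemma is_pin_iff: "is_pin n p \<longleftrightarrow> p \<in> pins n"
  by (cases p) (auto simp: pins_def)

lemma Inl_pins [simp]: "Inl a \<in> pins n \<longleftrightarrow> 1 \<le> a \<and> a \<le> n"
  and Inr_pins [simp]: "Inr a \<in> pins n \<longleftrightarrow> 1 \<le> a \<and> a \<le> n"
  by (auto simp: pins_def)

lemma is_code_iff:
  "is_code n c \<longleftrightarrow> length (fst c) = n \<and> length (snd c) = n \<and> pairing n (partner c)"
  by (simp add: is_code_def list_all_iff set_pin_list matched_def is_pin_iff pairing_def)

lemma dec_brauer: "is_code n c \<Longrightarrow> dec n c \<in> brauer n"
  by (simp add: dec_def is_code_iff blocks_brauer)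

lemma code_eqI:
  assumes "is_code n c" "is_code n d" "\<And>p. p \<in> pins n \<Longrightarrow> partner c p = partner d p"
  shows "c = d"
proof (rule prod_eqI)
  show "fst c = fst d"
  proof (rule nth_equalityI)
    fix i assume "i < length (fst c)"
    then show "fst c ! i = fst d ! i"
      using assms(1,2) assms(3)[of "Inl (Suc i)"] by (simp add: is_code_iff at_Suc)
  qed (use assms in \<open>simp add: is_code_iff\<close>)
  show "snd c = snd d"
  proof (rule nth_equalityI)
    fix i assume "i < length (snd c)"
    then show "snd c ! i = snd d ! i"
      using assms(1,2) assms(3)[of "Inr (Suc i)"] by (simp add: is_code_iff at_Suc)
  qed (use assms in \<open>simp add: is_code_iff\<close>)
qed

lemma dec_mem_iff:
  "is_code n c \<Longrightarrow> p \<in> pins n \<Longrightarrow> {p, q} \<in> dec n c \<longleftrightarrow> q = partner c p"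
  by (simp add: dec_def is_code_iff block_mem_iff)

lemma dec_inject:
  assumes "is_code n c" "is_code n d" "dec n c = dec n d"
  shows "c = d"
  using assms by (intro code_eqI[OF assms(1,2)]) (metis dec_mem_iff)

lemma brauer_decE:
  assumes "\<alpha> \<in> brauer n"
  obtains c where "is_code n c" "\<alpha> = dec n c"
proof -
  obtain f where f: "pairing n f" "\<alpha> = blocks n f"
    using brauer_blocksE[OF assms] .
  define c where "c = (map (\<lambda>a. f (Inl a)) [1..<Suc n], map (\<lambda>a. f (Inr a)) [1..<Suc n])"
  have c: "partner c p = f p" if "p \<in> pins n" for p
    using that by (cases p) (auto simp: c_def at_eq_nth simp del: upt_Suc)
  have "pairing n (partner c)"
    using f(1) unfolding pairing_def by (simp add: c)
  then have "is_code n c"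
    by (simp add: is_code_iff) (simp add: c_def)
  moreover have "\<alpha> = dec n c"
    unfolding f(2) dec_def blocks_def by (rule image_cong) (simp_all add: c)
  ultimately show thesis
    using that by blast
qed

section \<open>Walks in the picture of a product\<close>

lemma glued_edges_left:
  "{p, q} \<in> \<alpha> \<Longrightarrow> (case_sum Lft Mid p, case_sum Lft Mid q) \<in> glued_edges \<alpha> \<beta>"
  unfolding glued_edges_def by (auto intro!: bexI[of _ "{p, q}"])

lemma glued_edges_right:
  "{p, q} \<in> \<beta> \<Longrightarrow> (case_sum Mid Rgt p, case_sum Mid Rgt q) \<in> glued_edges \<alpha> \<beta>"
  unfolding glued_edges_def by (auto intro!: bexI[of _ "{p, q}"])

text \<open>Each recursive call follows one edge of the picture. \<open>XL\<close> arrives at a pin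
  of the left factor and \<open>XR\<close> at a pin of the right factor, hence the two embeddings of
  pins into vertices; the final pin is always an outer one. The condition on \<open>Inl 0\<close>
  excludes walks that ran out of fuel.\<close>

lemma exit_connected:
  fixes x y :: code and n :: nat
  defines "E \<equiv> (glued_edges (dec n x) (dec n y))\<^sup>*"
    and "XL \<equiv> exitL (snd x) (fst y)" and "XR \<equiv> exitR (snd x) (fst y)"
  assumes x: "is_code n x" and y: "is_code n y"
  shows "q \<in> pins n \<Longrightarrow> XL k q \<noteq> Inl 0 \<Longrightarrow> (case_sum Lft Mid q, case_sum Lft Rgt (XL k q)) \<in> E"
    and "q \<in> pins n \<Longrightarrow> XR k q \<noteq> Inl 0 \<Longrightarrow> (case_sum Mid Rgt q, case_sum Lft Rgt (XR k q)) \<in> E"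
proof (induction k arbitrary: q)
  case 0
  {
    case 1
    then show ?case by (cases q) (auto simp: E_def XL_def)
  next
    case 2
    then show ?case by (cases q) (auto simp: E_def XR_def)
  }
next
  case (Suc k)
  {
    case 1
    show ?case
    proof (cases q)
      case (Inl a)
      then show ?thesis by (simp add: E_def XL_def)
    next
      case (Inr a)
      let ?r = "partner y (Inl a)"
      have "?r \<in> pins n" "{Inl a, ?r} \<in> dec n y"
        using 1 Inr y by (auto simp: is_code_iff pairingD dec_mem_iff simp del: partner.simps)
      moreover have "XL (Suc k) q = XR k ?r"
        by (simp add: Inr XL_def XR_def)
      ultimately show ?thesis
        using Suc(2)[of ?r] 1(2) glued_edges_right[of "Inl a" ?r] Inr
        unfolding E_def by (auto intro: converse_rtrancl_into_rtrancl simp del: partner.simps)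
    qed
  next
    case 2
    show ?case
    proof (cases q)
      case (Inr a)
      then show ?thesis by (simp add: E_def XR_def)
    next
      case (Inl a)
      let ?r = "partner x (Inr a)"
      have "?r \<in> pins n" "{Inr a, ?r} \<in> dec n x"
        using 2 Inl x by (auto simp: is_code_iff pairingD dec_mem_iff simp del: partner.simps)
      moreover have "XR (Suc k) q = XL k ?r"
        by (simp add: Inl XL_def XR_def)
      ultimately show ?thesis
        using Suc(1)[of ?r] 2(2) glued_edges_left[of "Inr a" ?r] Inl
        unfolding E_def by (auto intro: converse_rtrancl_into_rtrancl simp del: partner.simps)
    qed
  }
qed

text \<open>Extra fuel is never consumed by a walk that has already left the middle; this is what
  makes its end independent of the fuel.\<close>

lemma exit_mono:
  "exitL R L k q \<noteq> Inl 0 \<Longrightarrow> k \<le> k' \<Longrightarrow> exitL R L k' q = exitL R L k q"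
  "exitR R L k q \<noteq> Inl 0 \<Longrightarrow> k \<le> k' \<Longrightarrow> exitR R L k' q = exitR R L k q"
proof (induction k arbitrary: k' q)
  case 0
  {
    case 1
    then show ?case by (cases q) auto
  next
    case 2
    then show ?case by (cases q) auto
  }
next
  case (Suc k)
  {
    case 1
    then obtain j where "k' = Suc j" "k \<le> j" by (cases k') auto
    with 1 show ?case using Suc(2)[of "at L (projr q)" j] by (cases q) simp_all
  next
    case 2
    then obtain j where "k' = Suc j" "k \<le> j" by (cases k') auto
    with 2 show ?case using Suc(1)[of "at R (projl q)" j] by (cases q) simp_all
  }
qed

text \<open>Taking the ends over all amounts of fuel turns the recursion of the walk into equations
  without fuel (\<open>ends_simps\<close>). The set has at most one element, and it is empty for a
  walk that never leaves the middle, as on a closed loop.\<close>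

definition endsL :: "code \<Rightarrow> code \<Rightarrow> pin \<Rightarrow> pin set" where
  "endsL x y q = {w. w \<noteq> Inl 0 \<and> (\<exists>k. exitL (snd x) (fst y) k q = w)}"

definition endsR :: "code \<Rightarrow> code \<Rightarrow> pin \<Rightarrow> pin set" where
  "endsR x y q = {w. w \<noteq> Inl 0 \<and> (\<exists>k. exitR (snd x) (fst y) k q = w)}"

lemma ends_simps:
  "a \<noteq> 0 \<Longrightarrow> endsL x y (Inl a) = {Inl a}"
  "endsR x y (Inr a) = {Inr a}"
  "endsL x y (Inr a) = endsR x y (partner y (Inl a))"
  "endsR x y (Inl a) = endsL x y (partner x (Inr a))"
proof -
  have "(\<exists>k. exitL (snd x) (fst y) k (Inr a) = w) \<longleftrightarrow> (\<exists>k. exitR (snd x) (fst y) k (partner y (Inl a)) = w)"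
    if "w \<noteq> Inl 0" for w
    using that by (metis exitL.simps(2,3) not0_implies_Suc partner.simps(1))
  then show "endsL x y (Inr a) = endsR x y (partner y (Inl a))"
    unfolding endsL_def endsR_def by blast
  have "(\<exists>k. exitR (snd x) (fst y) k (Inl a) = w) \<longleftrightarrow> (\<exists>k. exitL (snd x) (fst y) k (partner x (Inr a)) = w)"
    if "w \<noteq> Inl 0" for w
    using that by (metis exitR.simps(2,3) not0_implies_Suc partner.simps(2))
  then show "endsR x y (Inl a) = endsL x y (partner x (Inr a))"
    unfolding endsL_def endsR_def by blast
qed (auto simp: endsL_def endsR_def)

lemma ends_eq:
  "exitL (snd x) (fst y) k q \<noteq> Inl 0 \<Longrightarrow> endsL x y q = {exitL (snd x) (fst y) k q}"
  "exitR (snd x) (fst y) k q \<noteq> Inl 0 \<Longrightarrow> endsR x y q = {exitR (snd x) (fst y) k q}"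
  unfolding endsL_def endsR_def by (auto, (metis exit_mono nle_le)+)

text \<open>The unordered pair of the two ends reached from a vertex is constant along every edge of the
  picture of a product; so two distinct outer pins are joined only if the walk leads from one to
  the other.\<close>

fun end_pair :: "code \<Rightarrow> code \<Rightarrow> vertex \<Rightarrow> pin set set" where
  "end_pair x y (Lft a) = {endsL x y (Inl a), endsL x y (partner x (Inl a))}"
| "end_pair x y (Mid a) = {endsR x y (Inl a), endsL x y (Inr a)}"
| "end_pair x y (Rgt a) = {endsR x y (Inr a), endsR x y (partner y (Inr a))}"

text \<open>Written this way, the pair is visibly unchanged when a pin is exchanged with its
  partner, which is precisely a move along an edge of the left factor.\<close>

lemma end_pair_left: "end_pair x y (case_sum Lft Mid q) = {endsL x y q, endsL x y (partner x q)}"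
  by (cases q) (auto simp: ends_simps simp del: partner.simps)

lemma end_pair_right: "end_pair x y (case_sum Mid Rgt q) = {endsR x y q, endsR x y (partner y q)}"
  by (cases q) (auto simp: ends_simps simp del: partner.simps)

lemma end_pair_connected:
  assumes x: "is_code n x" and y: "is_code n y"
    and "(u, v) \<in> (glued_edges (dec n x) (dec n y))\<^sup>*"
  shows "end_pair x y u = end_pair x y v"
  using assms(3)
proof induction
  case (step v w)
  consider B where "B \<in> dec n x" "{v, w} = case_sum Lft Mid ` B"
    | B where "B \<in> dec n y" "{v, w} = case_sum Mid Rgt ` B"
    using step(2) unfolding glued_edges_def by auto
  then have "end_pair x y v = end_pair x y w"
  proof cases
    case (1 B)
    then obtain p where p: "p \<in> pins n" "B = {p, partner x p}"
      by (auto simp: dec_def blocks_def)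
    then have "partner x (partner x p) = p"
      using x pairingD(3)[of n "partner x" p] by (simp add: is_code_iff)
    then show ?thesis
      using 1(2) unfolding p(2) by (auto simp: doubleton_eq_iff end_pair_left)
  next
    case (2 B)
    then obtain p where p: "p \<in> pins n" "B = {p, partner y p}"
      by (auto simp: dec_def blocks_def)
    then have "partner y (partner y p) = p"
      using y pairingD(3)[of n "partner y" p] by (simp add: is_code_iff)
    then show ?thesis
      using 2(2) unfolding p(2) by (auto simp: doubleton_eq_iff end_pair_right)
  qed
  with step show ?case by simp
qed simp

lemma brauer_mult_dec:
  assumes x: "is_code n x" and y: "is_code n y" and z: "is_code n (code_mult n x y)"
  shows "brauer_mult n (dec n x) (dec n y) = dec n (code_mult n x y)"
proof -
  let ?h = "partner (code_mult n x y)"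
  let ?E = "(glued_edges (dec n x) (dec n y))\<^sup>*"
  have h: "?h p \<in> pins n" "?h p \<noteq> p" "?h p \<noteq> Inl 0" if "p \<in> pins n" for p
    using z that by (auto simp: is_code_iff pairingD) (metis Inl_pins not_one_le_zero pairingD(1))
  have hl: "?h (Inl a) = exitL (snd x) (fst y) n (partner x (Inl a))"
    and hr: "?h (Inr a) = exitR (snd x) (fst y) n (partner y (Inr a))" if "1 \<le> a" "a \<le> n" for a
    using that x y by (simp_all add: code_mult_def is_code_iff at_map)
  \<comment> \<open>An outer pin is its own end in one direction. In the other direction the walk
    with fuel n has ended, because its result \<open>?h p\<close> is a pin and hence differs from
    \<open>Inl 0\<close>.\<close>
  have pair: "end_pair x y (case_sum Lft Rgt p) = {{p}, {?h p}}" if "p \<in> pins n" for p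
  proof (cases p)
    case (Inl a)
    then show ?thesis
      using that hl[of a] h(3)[OF that] ends_eq(1)[of x y n "partner x (Inl a)"]
      by (auto simp: ends_simps simp del: partner.simps)
  next
    case (Inr a)
    then show ?thesis
      using that hr[of a] h(3)[OF that] ends_eq(2)[of x y n "partner y (Inr a)"]
      by (auto simp: ends_simps simp del: partner.simps)
  qed
  have conn: "(case_sum Lft Rgt p, case_sum Lft Rgt (?h p)) \<in> ?E" if "p \<in> pins n" for p
  proof (cases p)
    case (Inl a)
    let ?q = "partner x (Inl a)"
    have "{Inl a, ?q} \<in> dec n x" "?q \<in> pins n"
      using x that Inl by (auto simp: dec_mem_iff is_code_iff pairingD simp del: partner.simps)
    then show ?thesis
      using exit_connected(1)[OF x y, of ?q n] glued_edges_left[of "Inl a" ?q "dec n x" "dec n y"]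
        that hl[of a] h(3)[OF that] Inl
      by (auto intro: converse_rtrancl_into_rtrancl simp del: partner.simps)
  next
    case (Inr a)
    let ?q = "partner y (Inr a)"
    have "{Inr a, ?q} \<in> dec n y" "?q \<in> pins n"
      using y that Inr by (auto simp: dec_mem_iff is_code_iff pairingD simp del: partner.simps)
    then show ?thesis
      using exit_connected(2)[OF x y, of ?q n] glued_edges_right[of "Inr a" ?q "dec n y" "dec n x"]
        that hr[of a] h(3)[OF that] Inr
      by (auto intro: converse_rtrancl_into_rtrancl simp del: partner.simps)
  qed
  have only: "q = ?h p"
    if "p \<in> pins n" "q \<in> pins n" "p \<noteq> q" "(case_sum Lft Rgt p, case_sum Lft Rgt q) \<in> ?E" for p q
  proof -
    have "{{p}, {?h p}} = {{q}, {?h q}}"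
      using end_pair_connected[OF x y that(4)] pair[OF that(1)] pair[OF that(2)] by simp
    then have "{q} \<in> {{p}, {?h p}}"
      by simp
    then show ?thesis
      using \<open>p \<noteq> q\<close> by simp
  qed
  show ?thesis
  proof
    show "brauer_mult n (dec n x) (dec n y) \<subseteq> dec n (code_mult n x y)"
    proof
      fix B assume "B \<in> brauer_mult n (dec n x) (dec n y)"
      then obtain p q where "B = {p, q}" "p \<in> pins n" "q = ?h p"
        unfolding brauer_mult_def using only by blast
      then show "B \<in> dec n (code_mult n x y)"
        unfolding dec_def blocks_def by blast
    qed
    show "dec n (code_mult n x y) \<subseteq> brauer_mult n (dec n x) (dec n y)"
    proof
      fix B assume "B \<in> dec n (code_mult n x y)"
      then obtain p where p: "B = {p, ?h p}" "p \<in> pins n"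
        unfolding dec_def blocks_def by blast
      show "B \<in> brauer_mult n (dec n x) (dec n y)"
        unfolding brauer_mult_def
        by (rule CollectI, intro exI[of _ p] exI[of _ "?h p"] conjI p h(1) h(2)[symmetric] conn)
    qed
  qed
qed

section \<open>Classes, corank and enumeration of codes\<close>

lemma length_lefts [simp]: "length (lefts c) = length (fst c)"
  by (simp add: lefts_def)

lemma at_lefts:
  "is_code n c \<Longrightarrow> 1 \<le> a \<Longrightarrow> a \<le> n \<Longrightarrow> at (lefts c) a = left_of (partner c (Inl a))"
  by (simp add: lefts_def at_map is_code_iff)

lemma at_lefts_iff:
  assumes "is_code n c" "1 \<le> a" "a \<le> n" "1 \<le> b"
  shows "at (lefts c) a = b \<longleftrightarrow> partner c (Inl a) = Inl b"
  using assms by (cases "partner c (Inl a)") (auto simp: at_lefts)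

lemma at_lefts_0_iff:
  assumes "is_code n c" "1 \<le> a" "a \<le> n"
  shows "at (lefts c) a = 0 \<longleftrightarrow> (\<exists>b. 1 \<le> b \<and> b \<le> n \<and> partner c (Inl a) = Inr b)"
proof -
  have "partner c (Inl a) \<in> pins n"
    using assms by (simp add: is_code_iff pairingD del: partner.simps)
  then show ?thesis
    using assms by (cases "partner c (Inl a)") (auto simp: at_lefts)
qed

lemma at_lefts_le: 
  assumes "is_code n c" "1 \<le> a" "a \<le> n"
  shows "at (lefts c) a \<le> n"
proof -
  have "partner c (Inl a) \<in> pins n"
    using assms by (simp add: is_code_iff pairingD del: partner.simps)
  then show ?thesis
    using assms by (cases "partner c (Inl a)") (auto simp: at_lefts)
qed

lemma at_lefts_sym:
  assumes "is_code n c" "1 \<le> a" "a \<le> n" "at (lefts c) a \<noteq> 0"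
  shows "at (lefts c) (at (lefts c) a) = a" "at (lefts c) a \<noteq> a"
proof -
  define b where "b = at (lefts c) a"
  have b: "partner c (Inl a) = Inl b" "1 \<le> b" "b \<le> n"
    using assms at_lefts_iff[OF assms(1-3), of b] at_lefts_le[OF assms(1-3)] by (auto simp: b_def)
  have "partner c (partner c (Inl a)) = Inl a" "partner c (Inl a) \<noteq> Inl a"
    using assms pairingD[of n "partner c" "Inl a"] by (simp_all add: is_code_iff del: partner.simps)
  then show "at (lefts c) (at (lefts c) a) = a" "at (lefts c) a \<noteq> a"
    using at_lefts_iff[OF assms(1) b(2,3), of a] b assms unfolding b_def[symmetric] by auto
qed

lemma left_block_iff:
  assumes "is_code n c" "1 \<le> a" "a \<le> n" "1 \<le> b"
  shows "{Inl a, Inl b} \<in> dec n c \<longleftrightarrow> at (lefts c) a = b"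
  using assms by (auto simp: dec_mem_iff at_lefts_iff simp del: partner.simps)

lemma left_blocks_dec:
  assumes "is_code n c"
  shows "{B \<in> dec n c. B \<subseteq> Inl ` {1..n}} =
    {{Inl a, Inl b} |a b. 1 \<le> a \<and> a \<le> n \<and> 1 \<le> b \<and> b \<le> n \<and> at (lefts c) a = b}" (is "?L = ?R")
proof
  show "?L \<subseteq> ?R"
  proof
    fix B assume B: "B \<in> ?L"
    then obtain p where p: "p \<in> pins n" "B = {p, partner c p}"
      by (auto simp: dec_def blocks_def)
    then obtain a b where "p = Inl a" "partner c p = Inl b" "1 \<le> b" "b \<le> n" "1 \<le> a" "a \<le> n"
      using B by auto
    then show "B \<in> ?R"
      using p at_lefts_iff[OF assms, of a b] by auto
  qed
  show "?R \<subseteq> ?L"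
    using left_block_iff[OF assms] by auto
qed

lemma green_R_dec_iff:
  assumes c: "is_code n c" and d: "is_code n d"
  shows "(dec n c, dec n d) \<in> green_R n \<longleftrightarrow> lefts c = lefts d"
proof
  assume "lefts c = lefts d"
  then have "{B \<in> dec n c. B \<subseteq> Inl ` {1..n}} = {B \<in> dec n d. B \<subseteq> Inl ` {1..n}}"
    by (simp only: left_blocks_dec[OF c] left_blocks_dec[OF d])
  then show "(dec n c, dec n d) \<in> green_R n"
    unfolding green_R_def using c d by (simp only: dec_brauer mem_Collect_eq case_prod_conv simp_thms)
next
  assume "(dec n c, dec n d) \<in> green_R n"
  then have eq: "{B \<in> dec n c. B \<subseteq> Inl ` {1..n}} = {B \<in> dec n d. B \<subseteq> Inl ` {1..n}}"
    by (simp add: green_R_def)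
  have iff: "at (lefts c) a = b \<longleftrightarrow> at (lefts d) a = b"
    if "1 \<le> a" "a \<le> n" "1 \<le> b" "b \<le> n" for a b
  proof -
    have "{Inl a, Inl b} \<in> dec n c \<longleftrightarrow> {Inl a, Inl b} \<in> dec n d"
      using eq that by (auto simp: set_eq_iff)
    then show ?thesis
      using that c d by (simp add: left_block_iff)
  qed
  show "lefts c = lefts d"
  proof (rule nth_equalityI)
    show "length (lefts c) = length (lefts d)"
      using c d by (simp add: is_code_iff)
    fix i assume "i < length (lefts c)"
    then have i: "1 \<le> Suc i" "Suc i \<le> n" "i < length (lefts d)"
      using c d by (auto simp: is_code_iff)
    \<comment> \<open>Blocks determine only the nonzero entries; a zero on one side then excludes a
      nonzero value on the other.\<close>
    have "at (lefts c) (Suc i) = at (lefts d) (Suc i)"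
      using iff[OF i(1,2), of "at (lefts c) (Suc i)"] iff[OF i(1,2), of "at (lefts d) (Suc i)"]
        at_lefts_le[OF c i(1,2)] at_lefts_le[OF d i(1,2)]
      by (cases "at (lefts c) (Suc i) = 0"; cases "at (lefts d) (Suc i) = 0") auto
    then show "lefts c ! i = lefts d ! i"
      using \<open>i < length (lefts c)\<close> i(3) by (simp add: at_Suc)
  qed
qed

section \<open>Corank and canonical elements in terms of codes\<close>

lemma left_degree_card:
  assumes "length w = n"
  shows "left_degree w = card {a \<in> {1..n}. at w a \<noteq> 0}"
proof -
  have "left_degree w = card {i. i < n \<and> w ! i \<noteq> 0}"
    by (simp add: left_degree_def length_filter_conv_card assms)
  also have "\<dots> = card (Suc ` {i. i < n \<and> w ! i \<noteq> 0})"
    by (simp add: card_image)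
  also have "Suc ` {i. i < n \<and> w ! i \<noteq> 0} = {a \<in> {1..n}. at w a \<noteq> 0}" (is "?A = ?B")
  proof
    show "?A \<subseteq> ?B"
      using assms by (auto simp: at_Suc)
    show "?B \<subseteq> ?A"
    proof
      fix a assume "a \<in> ?B"
      then show "a \<in> ?A"
        using assms by (auto simp: at_eq_nth image_iff intro!: exI[of _ "a - 1"])
    qed
  qed
  finally show ?thesis .
qed

text \<open>A block crossing from left to right is determined by its left pin, and these pins are
  exactly the zero entries of \<open>lefts c\<close>.\<close>

lemma corank_dec:
  assumes c: "is_code n c"
  shows "corank n (dec n c) = left_degree (lefts c)"
proof -
  let ?Z = "{a \<in> {1..n}. at (lefts c) a = 0}"
  have "{B \<in> dec n c. \<exists>a\<in>{1..n}. \<exists>b\<in>{1..n}. B = {Inl a, Inr b}} =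
      (\<lambda>a. {Inl a, partner c (Inl a)}) ` ?Z" (is "?T = ?I")
  proof
    show "?T \<subseteq> ?I"
    proof
      fix B assume "B \<in> ?T"
      then obtain a b where ab: "1 \<le> a" "a \<le> n" "1 \<le> b" "b \<le> n" "B = {Inl a, Inr b}" "B \<in> dec n c"
        by auto
      then have "partner c (Inl a) = Inr b"
        using c by (simp add: dec_mem_iff del: partner.simps)
      then show "B \<in> ?I"
        using ab at_lefts_0_iff[OF c ab(1,2)] by (intro image_eqI[of _ _ a]) (auto simp del: partner.simps)
    qed
    show "?I \<subseteq> ?T"
    proof
      fix B assume "B \<in> ?I"
      then obtain a where a: "1 \<le> a" "a \<le> n" "at (lefts c) a = 0" "B = {Inl a, partner c (Inl a)}"
        by auto
      then obtain b where "1 \<le> b" "b \<le> n" "partner c (Inl a) = Inr b"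
        using at_lefts_0_iff[OF c] by blast
      moreover from this have "{Inl a, Inr b} \<in> dec n c"
        using a c by (simp add: dec_mem_iff del: partner.simps)
      ultimately have "B \<in> dec n c" "a \<in> {1..n}" "b \<in> {1..n}" "B = {Inl a, Inr b}"
        using a(1,2,4) by (simp_all del: partner.simps)
      then show "B \<in> ?T"
        by blast
    qed
  qed
  moreover have "inj_on (\<lambda>a. {Inl a, partner c (Inl a)}) ?Z"
  proof (rule inj_onI)
    fix a b assume "a \<in> ?Z" "b \<in> ?Z" "{Inl a, partner c (Inl a)} = {Inl b, partner c (Inl b)}"
    moreover from this obtain a' where "partner c (Inl a) = Inr a'"
      using at_lefts_0_iff[OF c, of a] by auto
    ultimately show "a = b"
      by (auto simp: doubleton_eq_iff)
  qed
  ultimately have "corank n (dec n c) = n - card ?Z"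
    by (simp add: corank_def card_image)
  also have "?Z = {1..n} - {a \<in> {1..n}. at (lefts c) a \<noteq> 0}"
    by auto
  also have "card \<dots> = n - left_degree (lefts c)"
    using c by (subst card_Diff_subset) (auto simp: left_degree_card[of _ n] is_code_iff)
  also have "n - (n - left_degree (lefts c)) = left_degree (lefts c)"
  proof -
    have "left_degree (lefts c) \<le> n"
      using c length_filter_le[of _ "lefts c"] by (simp add: left_degree_def is_code_iff) 
    then show ?thesis by simp
  qed
  finally show ?thesis .
qed

lemma canonical_code_iff:
  assumes c: "is_code n c"
  shows "canonical_code n c \<longleftrightarrow> (\<forall>k. corank n (dec n c) = 2 * k \<longrightarrow>
    (\<forall>m<k. {Inr (n - 2 * k + 2 * m + 1), Inr (n - 2 * k + 2 * m + 2)} \<in> dec n c))"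
proof -
  let ?d = "left_degree (lefts c)"
  \<comment> \<open>Keeps \<open>n - ?d\<close> from truncating, so that every tail start and its
    successor are pins.\<close>
  have "?d \<le> n"
    using c length_filter_le[of _ "lefts c"] by (simp add: left_degree_def is_code_iff)
  moreover have "{Inr b, Inr (b + 1)} \<in> dec n c \<longleftrightarrow> at (snd c) b = Inr (b + 1)"
    if "1 \<le> b" "b \<le> n" for b
    using that c by (auto simp: dec_mem_iff)
  ultimately show ?thesis
    by (auto simp: canonical_code_def tail_starts_def list_all_iff corank_dec[OF c] elim!: evenE)
qed

text \<open>Follows the branch that always chooses \<open>f p\<close>. The accumulator agrees with
  \<open>f\<close>, and a point still to come that has been used is already a key. Hence for a
  \<open>p\<close> without a key the value \<open>f p\<close> is free: were it a second component,
  its entry would have the key \<open>f (f p) = p\<close>; were it a key, the attached point would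
  be \<open>p\<close> by injectivity of \<open>f\<close>, and \<open>p\<close> would be used without
  being a key.\<close>

lemma assignments_complete:
  assumes "\<And>p. p \<in> S \<Longrightarrow> f p \<in> S \<and> f (f p) = p" "set ps \<subseteq> S" "distinct ps"
    and "\<And>v q. (v, q) \<in> set acc \<Longrightarrow> q \<in> S \<and> f q = v"
    and "\<And>q. q \<in> set ps \<Longrightarrow> q \<in> snd ` set acc \<Longrightarrow> q \<in> fst ` set acc"
    and "\<And>p. p \<in> set ps \<Longrightarrow> p \<in> fst ` set acc \<or> f p \<in> set (opts p)"
  shows "map f ps \<in> set (assignments acc opts ps)"
  using assms(2-)
proof (induction ps arbitrary: acc)
  case (Cons p ps)
  note inv = assms(1)
  have p: "p \<in> S"
    using Cons.prems(1) by simp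
  show ?case
  proof (cases "map_of acc p")
    case (Some q)
    then have "(p, q) \<in> set acc"
      by (rule map_of_SomeD)
    then have "f p = q"
      using Cons.prems(3)[of p q] inv[of q] by auto
    moreover have "map f ps \<in> set (assignments acc opts ps)"
      using Cons.prems by (intro Cons.IH) auto
    ultimately show ?thesis
      by (simp add: Some)
  next
    case None
    then have new: "p \<notin> fst ` set acc"
      by (simp add: map_of_eq_None_iff)
    have "f p \<notin> snd ` set acc"
    proof
      assume "f p \<in> snd ` set acc"
      then obtain r where "(r, f p) \<in> set acc" by auto
      then show False
        using Cons.prems(3)[of r "f p"] inv[OF p] new by force
    qed
    moreover have "f p \<notin> fst ` set acc"
    proof
      assume "f p \<in> fst ` set acc"
      then obtain q where q: "(f p, q) \<in> set acc" by auto
      then have "q \<in> S" "f q = f p"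
        using Cons.prems(3) by blast+
      then have "q = p"
        using inv[OF p] inv[of q] by metis
      with q have "p \<in> snd ` set acc" by force
      then show False
        using Cons.prems(4)[of p] new by simp
    qed
    moreover have "f p \<in> set (opts p)"
      using Cons.prems(5)[of p] new by simp
    moreover have "map f ps \<in> set (assignments ((f p, p) # acc) opts ps)"
    proof (rule Cons.IH)
      show "q \<in> S \<and> f q = v" if "(v, q) \<in> set ((f p, p) # acc)" for v q
        using that Cons.prems(3) p by auto
      show "q \<in> fst ` set ((f p, p) # acc)"
        if "q \<in> set ps" "q \<in> snd ` set ((f p, p) # acc)" for q
        using that Cons.prems(2,4) by auto
    qed (use Cons.prems in auto)
    ultimately show ?thesis
      using None by auto
  qed
qed simp

lemma map_partner_pin_list:
  assumes "is_code n c"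
  shows "map (partner c) (pin_list n) = fst c @ snd c"
proof -
  have "map (at xs) [1..<Suc n] = xs" if "length xs = n" for xs :: "pin list"
    using that by (intro nth_equalityI) (auto simp: at_Suc simp del: upt_Suc)
  then show ?thesis
    using assms by (simp add: pin_list_def comp_def is_code_iff del: upt_Suc)
qed

text \<open>All forced pairs are blocks of \<open>c\<close>: those on the left by the choice of the
  class, those on the right by canonicity. Thus the partner map of \<open>c\<close> is among the
  enumerated involutions.\<close>

lemma cands_complete:
  assumes c: "is_code n c" and canon: "canonical_code n c"
  shows "c \<in> set (cands n (lefts c))"
proof -
  let ?w = "lefts c" and ?f = "partner c"
  let ?acc = "forced n ?w"
  let ?tails = "tail_starts n (left_degree ?w)"
  have pair: "?f p \<in> pins n" "?f (?f p) = p" if "p \<in> pins n" for p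
    using c that pairingD[of n ?f p] by (simp_all add: is_code_iff)
  have tails: "1 \<le> b" "b + 1 \<le> n" "?f (Inr b) = Inr (b + 1)" "?f (Inr (b + 1)) = Inr b"
    if "b \<in> set ?tails" for b
  proof -
    have "left_degree ?w \<le> n"
      using c length_filter_le[of _ "lefts c"] by (simp add: left_degree_def is_code_iff)
    then show b: "1 \<le> b" "b + 1 \<le> n"
      using that by (auto simp: tail_starts_def split: if_splits)
    show "?f (Inr b) = Inr (b + 1)"
      using canon that by (simp add: canonical_code_def list_all_iff)
    then show "?f (Inr (b + 1)) = Inr b"
      using pair(2)[of "Inr b"] b by simp
  qed
  have mem: "(v, q) \<in> set ?acc \<longleftrightarrow>
      (\<exists>a. 1 \<le> a \<and> a \<le> n \<and> at ?w a \<noteq> 0 \<and> v = Inl (at ?w a) \<and> q = Inl a) \<or>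
      (\<exists>b\<in>set ?tails. v = Inr b \<and> q = Inr (b + 1) \<or> v = Inr (b + 1) \<and> q = Inr b)" for v q
    by (auto simp: forced_def simp del: upt_Suc)
  have acc: "q \<in> pins n \<and> ?f q = v" if "(v, q) \<in> set ?acc" for v q
    using that unfolding mem
  proof (elim disjE exE bexE conjE)
    fix a assume "1 \<le> a" "a \<le> n" "at ?w a \<noteq> 0" "v = Inl (at ?w a)" "q = Inl a"
    then show ?thesis
      using at_lefts_iff[OF c, of a "at ?w a"] by (simp del: partner.simps)
  next
    fix b assume "b \<in> set ?tails" "v = Inr b" "q = Inr (b + 1)"
    then show ?thesis
      using tails[of b] by (simp del: partner.simps)
  next
    fix b assume "b \<in> set ?tails" "v = Inr (b + 1)" "q = Inr b"
    then show ?thesis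
      using tails[of b] by (simp del: partner.simps)
  qed
  \<comment> \<open>For a left block the reversed entry is the one produced by the other end,
    \<open>at ?w a\<close>; the right blocks are listed in both orientations.\<close>
  have swap: "(q, v) \<in> set ?acc" if "(v, q) \<in> set ?acc" for v q
    using that unfolding mem
  proof (elim disjE exE bexE conjE, goal_cases)
    case (1 a)
    then show ?case
      using at_lefts_sym[OF c, of a] at_lefts_le[OF c, of a]
      by (intro disjI1 exI[of _ "at ?w a"]) auto
  qed auto
  have "map ?f (pin_list n) \<in> set (assignments ?acc
      (case_sum (\<lambda>a. map Inr [1..<Suc n]) (\<lambda>b. pin_list n)) (pin_list n))"
  proof (rule assignments_complete[where S = "pins n"])
    show "distinct (pin_list n)"
      by (auto simp: pin_list_def distinct_map simp del: upt_Suc)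
    show "q \<in> fst ` set ?acc" if "q \<in> snd ` set ?acc" for q
      using that swap by force
    show "p \<in> fst ` set ?acc \<or> ?f p \<in> set (case_sum (\<lambda>a. map Inr [1..<Suc n]) (\<lambda>b. pin_list n) p)"
      if "p \<in> set (pin_list n)" for p
    proof (cases p)
      case (Inl a)
      then have a: "1 \<le> a" "a \<le> n"
        using that by (auto simp: set_pin_list)
      show ?thesis
      proof (cases "at ?w a = 0")
        case True
        then show ?thesis
          using at_lefts_0_iff[OF c a] Inl by (auto simp del: upt_Suc partner.simps)
      next
        case False
        then have "(Inl (at ?w a), p) \<in> set ?acc"
          using a Inl by (auto simp: mem)
        then show ?thesis
          using swap by force
      qed
    next
      case (Inr b)
      then show ?thesis
        using that pair(1)[of p] by (simp add: set_pin_list del: partner.simps)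
    qed
  qed (use acc pair in \<open>auto simp: set_pin_list simp del: partner.simps\<close>)
  then have "fst c @ snd c \<in> set (assignments ?acc
      (case_sum (\<lambda>a. map Inr [1..<Suc n]) (\<lambda>b. pin_list n)) (pin_list n))"
    by (simp add: map_partner_pin_list[OF c])
  moreover have "split_code n (fst c @ snd c) = c"
    using c by (simp add: split_code_def is_code_iff)
  ultimately show ?thesis
    unfolding cands_def using c canon by (force simp: image_iff)
qed

lemma zero_fixpoints_map:
  "zero_fixpoints a (map f [a..<a + k]) = map (\<lambda>b. if b = f b then 0 else f b) [a..<a + k]"
proof (induction k arbitrary: a)
  case (Suc k)
  have "[a..<a + Suc k] = a # [Suc a..<Suc a + k]"
    by (simp add: upt_conv_Cons)
  then show ?case
    using Suc[of "Suc a"] by simp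
qed simp

lemma classes_complete:
  assumes c: "is_code n c"
  shows "lefts c \<in> set (classes n)"
proof -
  let ?w = "lefts c"
  \<comment> \<open>Turning zeros into fixed points makes \<open>lefts c\<close> an involution of
    {1..n}; \<open>zero_fixpoints\<close> undoes this, since no pin is its own partner.\<close>
  define f where "f a = (if at ?w a = 0 then a else at ?w a)" for a
  have f: "f a \<in> {1..n} \<and> f (f a) = a" if "a \<in> {1..n}" for a
    using that at_lefts_sym[OF c, of a] at_lefts_le[OF c, of a] by (auto simp: f_def)
  have "map f [1..<Suc n] \<in> set (assignments [] (\<lambda>a. [1..<Suc n]) [1..<Suc n])"
    using f by (intro assignments_complete[where S = "{1..n}"]) (auto simp: less_Suc_eq_le simp del: upt_Suc)
  then have "zero_fixpoints 1 (map f [1..<Suc n]) \<in> set (classes n)"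
    by (auto simp: classes_def simp del: upt_Suc)
  also have "zero_fixpoints 1 (map f [1..<Suc n]) = map (\<lambda>b. if b = f b then 0 else f b) [1..<Suc n]"
    using zero_fixpoints_map[of 1 f n] by simp
  also have "\<dots> = ?w"
  proof (rule nth_equalityI)
    show "length (map (\<lambda>b. if b = f b then 0 else f b) [1..<Suc n]) = length ?w"
      using c by (simp add: is_code_iff)
    fix i assume "i < length (map (\<lambda>b. if b = f b then 0 else f b) [1..<Suc n])"
    then have i: "i < n" "i < length ?w"
      using c by (simp_all add: is_code_iff del: upt_Suc)
    then show "map (\<lambda>b. if b = f b then 0 else f b) [1..<Suc n] ! i = ?w ! i"
      using at_lefts_sym(2)[OF c, of "Suc i"] by (auto simp: f_def at_Suc simp del: upt_Suc)
  qed
  finally show ?thesis .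
qed

section \<open>Correctness of the search\<close>

lemma same_iff: "same b xs ys \<longleftrightarrow> b \<and> xs = ys"
  by (induction b xs ys rule: same.induct) auto

lemma lookup_eq: "lookup D k = map_of D k"
proof -
  have "lookup_from v D k = (case v of None \<Rightarrow> map_of D k | Some x \<Rightarrow> Some x)" for v
  proof (induction v D k rule: lookup_from.induct)
    case (3 l v ps k)
    then show ?case by (cases "l = k") (simp_all add: same_iff)
  qed auto
  then show ?thesis
    by (simp add: lookup_def)
qed

lemma same_code_iff: "same_code c d \<longleftrightarrow> fst c @ snd c = fst d @ snd d"
  by (cases c; cases d) (simp add: same_iff)

lemma code_append_inject:
  "length (fst c) = n \<Longrightarrow> length (fst d) = n \<Longrightarrow> fst c @ snd c = fst d @ snd d \<longleftrightarrow> c = d"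
  by (auto simp: prod_eq_iff)

section \<open>Tables and representatives of classes\<close>

definition tab_ok :: "nat \<Rightarrow> tab \<Rightarrow> bool" where
  "tab_ok n D \<longleftrightarrow> (\<forall>(w, c) \<in> set D. is_code n c \<and> canonical_code n c \<and> lefts c = w)"

text \<open>Going through \<open>map_of\<close> gives at most one code per class by construction: an
  entry shadowed by an earlier one with the same key does not count.\<close>

definition codes_of :: "tab \<Rightarrow> code set" where
  "codes_of D = {c. map_of D (lefts c) = Some c}"

lemma map_of_tab:
  assumes "tab_ok n D" "map_of D w = Some c"
  shows "is_code n c" "canonical_code n c" "lefts c = w" "c \<in> codes_of D"
  using assms map_of_SomeD[OF assms(2)] by (auto simp: tab_ok_def codes_of_def)

lemma codes_of_ok:
  assumes "tab_ok n D" "c \<in> codes_of D"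
  shows "is_code n c" "canonical_code n c"
  using assms map_of_tab[OF assms(1), of "lefts c" c] by (auto simp: codes_of_def)

lemma section_unique:
  assumes sec: "R_cross_section n \<Lambda>" and c: "is_code n c" "dec n c \<in> \<Lambda>"
    and d: "is_code n d" "dec n d \<in> \<Lambda>" and "lefts c = lefts d"
  shows "c = d"
proof -
  have "green_R n `` {dec n c} \<in> brauer n // green_R n"
    using c by (simp add: quotientI dec_brauer)
  then have "\<exists>!\<alpha>. \<alpha> \<in> \<Lambda> \<inter> green_R n `` {dec n c}"
    using sec unfolding R_cross_section_def by blast
  then have "dec n c = dec n d"
    using c d \<open>lefts c = lefts d\<close> by (metis IntI Image_singleton_iff green_R_dec_iff)
  then show ?thesis
    using dec_inject c(1) d(1) by blast
qed

lemma section_exists: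
  assumes sec: "R_cross_section n \<Lambda>" and c: "is_code n c"
  obtains d where "is_code n d" "lefts d = lefts c" "dec n d \<in> \<Lambda>"
proof -
  have "green_R n `` {dec n c} \<in> brauer n // green_R n"
    using c by (simp add: quotientI dec_brauer)
  then have "\<exists>!\<alpha>. \<alpha> \<in> \<Lambda> \<inter> green_R n `` {dec n c}"
    using sec unfolding R_cross_section_def by blast
  then obtain \<alpha> where \<alpha>: "\<alpha> \<in> \<Lambda>" "(dec n c, \<alpha>) \<in> green_R n"
    by auto
  then obtain d where "is_code n d" "\<alpha> = dec n d"
    using brauer_decE[of \<alpha> n] sec unfolding R_cross_section_def by blast
  then show thesis
    using that \<alpha> green_R_dec_iff[OF c] by auto
qed

lemma section_mult:
  assumes "R_cross_section n \<Lambda>" "is_code n x" "dec n x \<in> \<Lambda>" "is_code n y" "dec n y \<in> \<Lambda>"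
    "is_code n (code_mult n x y)"
  shows "dec n (code_mult n x y) \<in> \<Lambda>"
  using assms brauer_mult_dec[of n x y] unfolding R_cross_section_def by metis

lemma canonical_section_code:
  "canonical_R_cross_section n \<Lambda> \<Longrightarrow> is_code n c \<Longrightarrow> dec n c \<in> \<Lambda> \<Longrightarrow> canonical_code n c"
  unfolding canonical_R_cross_section_def canonical_code_iff by blast

definition one_code :: "nat \<Rightarrow> code" where
  "one_code n = (map Inr [1..<Suc n], map Inl [1..<Suc n])"

lemma partner_one_code:
  assumes "1 \<le> a" "a \<le> n"
  shows "partner (one_code n) (Inl a) = Inr a" "partner (one_code n) (Inr a) = Inl a"
  using assms by (auto simp: one_code_def at_eq_nth simp del: upt_Suc)

lemma is_code_one: "is_code n (one_code n)"
  unfolding is_code_iff pairing_def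
proof (intro conjI ballI)
  fix p assume "p \<in> pins n"
  then show "partner (one_code n) p \<in> pins n" "partner (one_code n) p \<noteq> p"
    "partner (one_code n) (partner (one_code n) p) = p"
    by (cases p; simp add: partner_one_code del: partner.simps)+
qed (simp_all add: one_code_def)

lemma lefts_one_code: "lefts (one_code n) = replicate n 0"
  by (simp add: lefts_def one_code_def comp_def map_replicate_const del: upt_Suc)

lemma dec_one_code: "dec n (one_code n) = brauer_one n"
proof
  show "dec n (one_code n) \<subseteq> brauer_one n"
  proof
    fix B assume "B \<in> dec n (one_code n)"
    then obtain p where "p \<in> pins n" "B = {p, partner (one_code n) p}"
      by (auto simp: dec_def blocks_def)
    then show "B \<in> brauer_one n"
      by (cases p) (auto simp: brauer_one_def partner_one_code insert_commute simp del: partner.simps)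
  qed
  show "brauer_one n \<subseteq> dec n (one_code n)"
    using is_code_one[of n]
    by (auto simp: brauer_one_def dec_mem_iff partner_one_code simp del: partner.simps)
qed

text \<open>The element of a cross-section without left blocks is a permutation equal to its own square.\<close>

lemma section_one:
  assumes sec: "R_cross_section n \<Lambda>"
  shows "dec n (one_code n) \<in> \<Lambda>"
proof -
  obtain d where d: "is_code n d" "lefts d = lefts (one_code n)" "dec n d \<in> \<Lambda>"
    using section_exists[OF sec is_code_one] by blast
  have zero: "at (lefts d) a = 0" if "1 \<le> a" "a \<le> n" for a
    using that by (simp add: d(2) lefts_one_code at_eq_nth)
  have out: "\<exists>b. 1 \<le> b \<and> b \<le> n \<and> partner d (Inl a) = Inr b" if "1 \<le> a" "a \<le> n" for a
    using at_lefts_0_iff[OF d(1) that] zero[OF that] by simp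
  \<comment> \<open>The square is handled as an abstract element \<open>e\<close> of \<Lambda>.
    Applying \<open>brauer_mult_dec\<close> would require the computed product to be a code, which
    is not at hand for a general n.\<close>
  have sq: "brauer_mult n (dec n d) (dec n d) \<in> \<Lambda>"
    using sec d(3) unfolding R_cross_section_def by blast
  then obtain e where e: "is_code n e" "brauer_mult n (dec n d) (dec n d) = dec n e"
    using brauer_decE sec unfolding R_cross_section_def by blast
  have double: "partner e (Inl a) = Inr c"
    if "1 \<le> a" "a \<le> n" "1 \<le> b" "b \<le> n" "partner d (Inl a) = Inr b" "partner d (Inl b) = Inr c" "1 \<le> c" "c \<le> n" for a b c
  proof -
    have "{Inl a, Inr b} \<in> dec n d" "{Inl b, Inr c} \<in> dec n d"
      using d(1) that by (auto simp: dec_mem_iff simp del: partner.simps)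
    then have "(Lft a, Mid b) \<in> glued_edges (dec n d) (dec n d)" "(Mid b, Rgt c) \<in> glued_edges (dec n d) (dec n d)"
      using glued_edges_left[of "Inl a" "Inr b"] glued_edges_right[of "Inl b" "Inr c"] by auto
    then have "(case_sum Lft Rgt (Inl a), case_sum Lft Rgt (Inr c)) \<in> (glued_edges (dec n d) (dec n d))\<^sup>*"
      by auto
    then have "{Inl a, Inr c} \<in> brauer_mult n (dec n d) (dec n d)"
      unfolding brauer_mult_def using that by (intro CollectI exI[of _ "Inl a"] exI[of _ "Inr c"]) auto
    then show ?thesis
      using e that by (simp add: dec_mem_iff del: partner.simps)
  qed
  have "at (lefts e) a = 0" if a: "1 \<le> a" "a \<le> n" for a
  proof -
    obtain b where b: "1 \<le> b" "b \<le> n" "partner d (Inl a) = Inr b"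
      using out[OF a] by blast
    obtain c where "1 \<le> c" "c \<le> n" "partner d (Inl b) = Inr c"
      using out[OF b(1,2)] by blast
    then show ?thesis
      using at_lefts_0_iff[OF e(1) a] double[OF a b] by blast
  qed
  then have "lefts e = lefts d"
    using d(1) e(1) zero by (intro nth_equalityI) (auto simp: is_code_iff at_Suc[symmetric])
  then have "e = d"
    using section_unique[OF sec e(1) _ d(1,3)] sq e(2) by simp
  have fix_point: "partner d (Inl a) = Inr a" if a: "1 \<le> a" "a \<le> n" for a
  proof -
    obtain b where b: "1 \<le> b" "b \<le> n" "partner d (Inl a) = Inr b"
      using out[OF a] by blast
    obtain c where c: "1 \<le> c" "c \<le> n" "partner d (Inl b) = Inr c"
      using out[OF b(1,2)] by blast
    \<comment> \<open>With \<open>e = d\<close>, one and two applications of the permutation send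
      \<open>a\<close> to the same pin, so injectivity gives \<open>a = b\<close>.\<close>
    have "partner d (Inl a) = partner d (Inl b)"
      using double[OF a b c(3,1,2)] c(3) unfolding \<open>e = d\<close> by simp
    moreover have "partner d (partner d (Inl a)) = Inl a" "partner d (partner d (Inl b)) = Inl b"
      using d(1) a b pairingD(3)[of n "partner d" "Inl a"] pairingD(3)[of n "partner d" "Inl b"]
      by (simp_all add: is_code_iff del: partner.simps)
    ultimately show ?thesis
      using b(3) by (metis Inl_inject)
  qed
  have "d = one_code n"
  proof (rule code_eqI[OF d(1) is_code_one])
    fix p assume p: "p \<in> pins n"
    show "partner d p = partner (one_code n) p"
    proof (cases p)
      case (Inl a)
      then show ?thesis
        using p fix_point[of a] by (simp add: partner_one_code del: partner.simps)
    next
      case (Inr a)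
      then have "partner d (partner d (Inl a)) = Inl a" "partner d (Inl a) = Inr a"
        using p d(1) pairingD(3)[of n "partner d" "Inl a"] fix_point[of a]
        by (auto simp: is_code_iff simp del: partner.simps)
      then show ?thesis
        using p Inr by (simp add: partner_one_code del: partner.simps)
    qed
  qed
  then show ?thesis
    using d(3) by simp
qed

section \<open>Why a branch inside a given cross-section survives\<close>

definition inside :: "nat \<Rightarrow> pin set set set \<Rightarrow> tab \<Rightarrow> bool" where
  "inside n \<Lambda> D \<longleftrightarrow> tab_ok n D \<and> (\<forall>(w, c) \<in> set D. dec n c \<in> \<Lambda>)"

text \<open>A version that mentions no cross-section: in the direction from tables to
  cross-sections, none containing the table is known yet.\<close>

lemma insert_code_tab_ok:
  assumes "tab_ok n D" "insert_code n z D = Some D'"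
  shows "tab_ok n D'"
proof (cases "map_of D (lefts z)")
  case None
  then show ?thesis
    using assms by (cases "is_code n z")
      (auto simp: insert_code_def lookup_eq tab_ok_def split: if_splits)
next
  case (Some w)
  then show ?thesis
    using assms by (cases "same_code w z") (auto simp: insert_code_def lookup_eq split: if_splits)
qed

text \<open>Neither ground for refutation can occur inside \<Lambda>: an occupied class already
  holds \<open>z\<close> itself by uniqueness of representatives, and elements of \<Lambda> are
  canonical. Membership of \<open>z\<close> is assumed only if \<open>z\<close> is a code, which is
  all that \<open>section_mult\<close> provides for a product.\<close>

lemma insert_code_inside:
  assumes can: "canonical_R_cross_section n \<Lambda>" and D: "inside n \<Lambda> D"
    and z: "is_code n z \<Longrightarrow> dec n z \<in> \<Lambda>"
  obtains D' where "insert_code n z D = Some D'" "inside n \<Lambda> D'"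
proof (cases "is_code n z")
  case False
  then have "insert_code n z D = Some D"
    by (cases "map_of D (lefts z)"; (cases "same_code (the (map_of D (lefts z))) z")?)
      (auto simp: insert_code_def lookup_eq)
  then show ?thesis
    using D that by blast
next
  case code: True
  have canon: "canonical_code n z"
    using canonical_section_code[OF can code z[OF code]] .
  show ?thesis
  proof (cases "map_of D (lefts z)")
    case None
    then have "insert_code n z D = Some ((lefts z, z) # D)"
      using code canon by (simp add: insert_code_def lookup_eq)
    moreover have "inside n \<Lambda> ((lefts z, z) # D)"
      using D code canon z by (simp add: inside_def tab_ok_def)
    ultimately show ?thesis
      using that by blast
  next
    case (Some w)
    then have w: "is_code n w" "lefts w = lefts z" "dec n w \<in> \<Lambda>"
      using D map_of_tab[of n D] map_of_SomeD[OF Some] by (auto simp: inside_def)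
    then have "w = z"
      using section_unique[OF _ w(1,3) code z[OF code] w(2)] can
      unfolding canonical_R_cross_section_def by blast
    then have "insert_code n z D = Some D"
      using Some by (simp add: insert_code_def lookup_eq same_code_iff)
    then show ?thesis
      using D that by blast
  qed
qed

definition in_section :: "nat \<Rightarrow> pin set set set \<Rightarrow> code \<Rightarrow> bool" where
  "in_section n \<Lambda> c \<longleftrightarrow> is_code n c \<and> dec n c \<in> \<Lambda>"

lemma insert_product_inside:
  assumes "canonical_R_cross_section n \<Lambda>" "inside n \<Lambda> D" "in_section n \<Lambda> x" "in_section n \<Lambda> y"
  obtains D' where "insert_product n x y (Some D) = Some D'" "inside n \<Lambda> D'"
proof -
  have "dec n (code_mult n x y) \<in> \<Lambda>" if "is_code n (code_mult n x y)"
    using assms that section_mult[of n \<Lambda> x y]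
    by (simp add: in_section_def canonical_R_cross_section_def)
  then show thesis
    using insert_code_inside[OF assms(1,2), of "code_mult n x y"] that by auto
qed

lemma add_products_inside:
  assumes "canonical_R_cross_section n \<Lambda>" "inside n \<Lambda> D" "in_section n \<Lambda> x" "\<forall>y\<in>set ys. in_section n \<Lambda> y"
  shows "\<exists>D'. add_products n x ys (Some D) = Some D' \<and> inside n \<Lambda> D'"
  using assms(2,4)
proof (induction ys arbitrary: D)
  case (Cons y ys)
  then have y: "in_section n \<Lambda> y" by simp
  obtain D1 where D1: "insert_product n x y (Some D) = Some D1" "inside n \<Lambda> D1"
    using insert_product_inside[OF assms(1) Cons.prems(1) assms(3) y] .
  obtain D2 where "insert_product n y x (Some D1) = Some D2" "inside n \<Lambda> D2"
    using insert_product_inside[OF assms(1) D1(2) y assms(3)] .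
  then show ?case
    using Cons D1 by (simp del: insert_product.simps)
qed simp

lemma insert_product_tab_ok:
  "(\<And>E. D = Some E \<Longrightarrow> tab_ok n E) \<Longrightarrow> insert_product n x y D = Some D' \<Longrightarrow> tab_ok n D'"
  by (cases D) (auto intro: insert_code_tab_ok)

lemma add_products_tab_ok:
  "(\<And>E. D = Some E \<Longrightarrow> tab_ok n E) \<Longrightarrow> add_products n x ys D = Some D' \<Longrightarrow> tab_ok n D'"
proof (induction ys arbitrary: D)
  case (Cons y ys)
  show ?case
  proof (rule Cons.IH)
    show "add_products n x ys (insert_product n y x (insert_product n x y D)) = Some D'"
      using Cons.prems(2) by simp
    show "tab_ok n E" if "insert_product n y x (insert_product n x y D) = Some E" for E
      by (rule insert_product_tab_ok[OF _ that], rule insert_product_tab_ok[OF Cons.prems(1)])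
  qed
qed simp

lemma add_code_inside:
  assumes "canonical_R_cross_section n \<Lambda>" "inside n \<Lambda> D" "in_section n \<Lambda> x" "\<forall>y\<in>set G. in_section n \<Lambda> y"
  shows "\<exists>D'. add_code n x G D = Some D' \<and> inside n \<Lambda> D'"
proof -
  obtain D1 where "insert_code n x D = Some D1" "inside n \<Lambda> D1"
    using insert_code_inside[OF assms(1,2), of x] assms(3) by (auto simp: in_section_def)
  then show ?thesis
    using add_products_inside[OF assms(1) _ assms(3), of D1 "x # G"] assms(3,4)
    by (simp add: add_code_def del: add_products.simps)
qed

lemma add_code_tab_ok: "tab_ok n D \<Longrightarrow> add_code n x G D = Some D' \<Longrightarrow> tab_ok n D'"
  unfolding add_code_def using add_products_tab_ok insert_code_tab_ok by blast

lemma set_step1: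
  "set (step1 n G D xs) = {(x # G, D') |x D'. x \<in> set xs \<and> add_code n x G D = Some D'}"
proof (induction xs)
  case (Cons x xs)
  then show ?case by (cases x; cases "add_code n x G D") auto
qed simp

lemma set_step: "set (step n xs S) = (\<Union>(G, D)\<in>set S. set (step1 n G D xs))"
  by (induction n xs S rule: step.induct) auto

lemma step_memI:
  assumes "(G, D) \<in> set S" "x \<in> set xs" "add_code n x G D = Some D'"
  shows "(x # G, D') \<in> set (step n xs S)"
proof -
  have "(x # G, D') \<in> set (step1 n G D xs)"
    using assms(2,3) unfolding set_step1 by blast
  then show ?thesis
    using assms(1) unfolding set_step by blast
qed

definition good_state :: "nat \<Rightarrow> pin set set set \<Rightarrow> code list \<times> tab \<Rightarrow> bool" where
  "good_state n \<Lambda> s \<longleftrightarrow> (\<forall>y\<in>set (fst s). in_section n \<Lambda> y) \<and> inside n \<Lambda> (snd s)"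

text \<open>At each class one of the branches picks the element of \<Lambda>, and by
  \<open>add_code_inside\<close> that branch is not refuted. The other branches may die or lead to
  other cross-sections.\<close>

lemma search_inside:
  assumes can: "canonical_R_cross_section n \<Lambda>"
  shows "\<exists>s\<in>set S. good_state n \<Lambda> s \<Longrightarrow> \<forall>w\<in>set ws. \<exists>c\<in>set (cands n w). in_section n \<Lambda> c \<Longrightarrow>
    \<exists>s\<in>set (search n ws S). good_state n \<Lambda> s"
proof (induction ws arbitrary: S)
  case (Cons w ws)
  obtain G D where s: "(G, D) \<in> set S" "good_state n \<Lambda> (G, D)"
    using Cons.prems(1) by auto
  obtain c where c: "c \<in> set (cands n w)" "in_section n \<Lambda> c"
    using Cons.prems(2) by auto
  obtain D' where D': "add_code n c G D = Some D'" "inside n \<Lambda> D'"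
    using add_code_inside[OF can _ c(2), of D G] s(2) by (auto simp: good_state_def)
  have "(c # G, D') \<in> set (step n (cands n w) S)"
    using s(1) c(1) D'(1) by (rule step_memI)
  moreover have "good_state n \<Lambda> (c # G, D')"
    using s(2) c(2) D'(2) by (simp add: good_state_def)
  ultimately show ?case
    using Cons.IH[of "step n (cands n w) S"] Cons.prems(2) by auto
qed simp

lemma search_tab_ok:
  "\<forall>s\<in>set S. tab_ok n (snd s) \<Longrightarrow> \<forall>s\<in>set (search n ws S). tab_ok n (snd s)"
proof (induction ws arbitrary: S)
  case (Cons w ws)
  have "\<forall>s\<in>set (step n (cands n w) S). tab_ok n (snd s)"
    using Cons.prems by (auto simp: set_step set_step1 intro: add_code_tab_ok)
  then show ?case
    using Cons.IH by simp
qed simp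

lemma set_sections: "set (sections S) = snd ` set S"
  by (induction S rule: sections.induct) auto

lemma set_candsD: "c \<in> set (cands n w) \<Longrightarrow> is_code n c \<and> lefts c = w \<and> canonical_code n c"
  by (auto simp: cands_def)

lemma set_seedsD: "(w, c) \<in> set (seeds n ws) \<Longrightarrow> cands n w = [c]"
proof (induction ws)
  case (Cons v ws)
  then show ?case
    by (cases "(v, cands n v)" rule: seeds1.cases) auto
qed simp

lemma seed_cases:
  assumes "(w, c) \<in> set (seed n)"
  shows "w = replicate n 0 \<and> c = one_code n \<or> cands n w = [c]"
  using assms by (auto simp: seed_def one_code_def dest: set_seedsD simp del: upt_Suc)

lemma left_degree_zero: "left_degree (replicate n 0) = 0"
  by (simp add: left_degree_def)

lemma canonical_one_code: "canonical_code n (one_code n)"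
  by (simp add: canonical_code_def lefts_one_code left_degree_zero tail_starts_def)

lemma seed_tab_ok: "tab_ok n (seed n)"
  unfolding tab_ok_def
proof clarify
  fix w L R assume "(w, L, R) \<in> set (seed n)"
  then show "is_code n (L, R) \<and> canonical_code n (L, R) \<and> lefts (L, R) = w"
    using seed_cases[of w "(L, R)" n] set_candsD[of "(L, R)" n w]
    by (auto simp: is_code_one canonical_one_code lefts_one_code)
qed

lemma section_cand:
  assumes can: "canonical_R_cross_section n \<Lambda>" and "is_code n c"
  obtains d where "d \<in> set (cands n (lefts c))" "in_section n \<Lambda> d"
proof -
  have "R_cross_section n \<Lambda>"
    using can by (simp add: canonical_R_cross_section_def)
  then obtain d where "is_code n d" "lefts d = lefts c" "dec n d \<in> \<Lambda>"
    using section_exists \<open>is_code n c\<close> by blast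
  then show thesis
    using that[of d] cands_complete[of n d] canonical_section_code[OF can, of d]
    by (simp add: in_section_def)
qed

text \<open>\<Lambda> contributes some candidate to every inhabited class, so a sole candidate lies
  in \<Lambda>.\<close>

lemma seed_inside:
  assumes can: "canonical_R_cross_section n \<Lambda>"
  shows "inside n \<Lambda> (seed n)"
  unfolding inside_def
proof (intro conjI seed_tab_ok, clarify)
  fix w L R assume "(w, L, R) \<in> set (seed n)"
  then consider "(L, R) = one_code n" | "cands n w = [(L, R)]"
    using seed_cases by blast
  then show "dec n (L, R) \<in> \<Lambda>"
  proof cases
    case 1
    then show ?thesis
      using section_one can by (simp add: canonical_R_cross_section_def)
  next
    case 2
    then have "is_code n (L, R)" "lefts (L, R) = w"
      using set_candsD[of "(L, R)" n w] by simp_all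
    then show ?thesis
      using section_cand[OF can, of "(L, R)"] 2 by (auto simp: in_section_def)
  qed
qed

lemma found_tab_ok: "D \<in> set (found n) \<Longrightarrow> tab_ok n D"
  using search_tab_ok[of "[([], seed n)]" n] by (auto simp: found_def set_sections seed_tab_ok)

lemma found_inside:
  assumes can: "canonical_R_cross_section n \<Lambda>"
    and "\<And>w. w \<in> set (map (pair_class n) (corank_pairs n)) \<Longrightarrow> \<exists>c. is_code n c \<and> lefts c = w"
  shows "\<exists>D\<in>set (found n). inside n \<Lambda> D"
proof -
  have "\<exists>s\<in>set (search n (map (pair_class n) (corank_pairs n)) [([], seed n)]). good_state n \<Lambda> s"
  proof (rule search_inside[OF can])
    show "\<exists>s\<in>set [([], seed n)]. good_state n \<Lambda> s"
      using seed_inside[OF can] by (simp add: good_state_def)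
    show "\<forall>w\<in>set (map (pair_class n) (corank_pairs n)). \<exists>c\<in>set (cands n w). in_section n \<Lambda> c"
      using assms(2) section_cand[OF can] by metis
  qed
  then show ?thesis
    by (auto simp: found_def set_sections good_state_def)
qed

section \<open>Correctness of the closure check\<close>

definition section_of :: "nat \<Rightarrow> tab \<Rightarrow> pin set set set" where
  "section_of n D = dec n ` codes_of D"

lemma covers_iff: "covers D ok ws \<longleftrightarrow> ok \<and> (\<forall>w\<in>set ws. \<exists>c. map_of D w = Some c)"
proof (induction D ok ws rule: covers.induct)
  case (3 D w ws)
  then show ?case by (cases "map_of D w") (simp_all add: lookup_eq)
qed auto

lemma all_cover_iff: "all_cover ws S \<longleftrightarrow> (\<forall>D\<in>set S. \<forall>w\<in>set ws. \<exists>c. map_of D w = Some c)"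
  by (induction ws S rule: all_cover.induct) (auto simp: covers_iff)

lemma tag_nth:
  assumes "i < length S" "tab_ok n (S ! i)" "is_code n c"
  shows "tag S c ! i \<longleftrightarrow> c \<in> codes_of (S ! i)"
proof -
  have "tag S c ! i = has c (map_of (S ! i) (lefts c))"
    using \<open>i < length S\<close>
  proof (induction S arbitrary: i)
    case (Cons D S)
    then show ?case by (cases i) (simp_all add: lookup_eq)
  qed simp
  moreover have "has c (map_of (S ! i) (lefts c)) \<longleftrightarrow> map_of (S ! i) (lefts c) = Some c"
  proof (cases "map_of (S ! i) (lefts c)")
    case (Some d)
    then have "is_code n d"
      using map_of_tab(1)[OF assms(2)] by blast
    then show ?thesis
      using Some \<open>is_code n c\<close> code_append_inject[of c n d] by (auto simp: same_code_iff is_code_iff)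
  qed simp
  ultimately show ?thesis
    by (simp add: codes_of_def)
qed

lemma length_tag [simp]: "length (tag S c) = length S"
  by (induction S) auto

definition tagged_ok :: "nat \<Rightarrow> tab list \<Rightarrow> tagged \<Rightarrow> bool" where
  "tagged_ok n S U \<longleftrightarrow> (\<forall>(k, c, m) \<in> set U. is_code n c \<and> k = fst c @ snd c \<and> m = tag S c)"

text \<open>A key is the concatenation of both halves, so a hit identifies \<open>z\<close> once the
  length of the first half is known. The hit also certifies that \<open>z\<close> is a code; the
  closure check obtains the premise of \<open>brauer_mult_dec\<close> in this way.\<close>

lemma tagged_lookup:
  assumes "tagged_ok n S U" "length (fst z) = n" "map_of U (fst z @ snd z) = Some (c, m)"
  shows "c = z" "is_code n z" "m = tag S z"
proof -
  have "is_code n c \<and> fst z @ snd z = fst c @ snd c \<and> m = tag S c"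
    using map_of_SomeD[OF assms(3)] assms(1) by (auto simp: tagged_ok_def)
  then show "c = z" "is_code n z" "m = tag S z"
    using code_append_inject[of z n c] assms(2) by (auto simp: is_code_iff)
qed

lemma tag_codes_ok:
  assumes "tagged_ok n S U" "tab_ok n D"
  shows "tagged_ok n S (tag_codes S U D) \<and> set U \<subseteq> set (tag_codes S U D) \<and>
    (\<forall>(w, c) \<in> set D. (fst c @ snd c, c, tag S c) \<in> set (tag_codes S U D))"
  using assms
proof (induction D arbitrary: U)
  case (Cons e D)
  obtain w c where e: "e = (w, c)" by (cases e)
  let ?V = "tag_insert S U c (map_of U (fst c @ snd c))"
  have c: "is_code n c" and D: "tab_ok n D"
    using Cons.prems(2) by (auto simp: e tab_ok_def)
  have "tagged_ok n S ?V \<and> set U \<subseteq> set ?V \<and> (fst c @ snd c, c, tag S c) \<in> set ?V"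
  proof (cases "map_of U (fst c @ snd c)")
    case None
    then show ?thesis
      using Cons.prems(1) c by (auto simp: tagged_ok_def)
  next
    case (Some v)
    obtain c' m where v: "v = (c', m)" by (cases v)
    have "c' = c" "m = tag S c"
      using tagged_lookup[OF Cons.prems(1) _ Some[unfolded v]] c by (simp_all add: is_code_iff)
    then show ?thesis
      using map_of_SomeD[OF Some] Cons.prems(1) by (simp add: Some v)
  qed
  then show ?case
    using Cons.IH[OF _ D, of ?V] by (auto simp: e lookup_eq)
qed simp

lemma meet_empty_nth: "meet_empty a b \<Longrightarrow> i < length a \<Longrightarrow> i < length b \<Longrightarrow> a ! i \<Longrightarrow> \<not> b ! i"
proof (induction a b arbitrary: i rule: meet_empty.induct)
qed (auto simp: nth_Cons split: nat.splits)

lemma meet_le_nth: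
  "meet_le a b c \<Longrightarrow> i < length a \<Longrightarrow> i < length b \<Longrightarrow> i < length c \<Longrightarrow> a ! i \<Longrightarrow> b ! i \<Longrightarrow> c ! i"
proof (induction a b c arbitrary: i rule: meet_le.induct)
qed (auto simp: nth_Cons split: nat.splits)

lemma closed_row_iff:
  "closed_row n U x a ok V \<longleftrightarrow> ok \<and> (\<forall>(k, y, b) \<in> set V. check_pair n U x a y b (meet_empty a b))"
proof (induction n U x a ok V rule: closed_row.induct)
  case (3 n U x a k y b V)
  then show ?case by (simp del: check_pair.simps)
qed auto

lemma closed_rows_iff:
  "closed_rows n U ok V \<longleftrightarrow> ok \<and> (\<forall>(k, x, a) \<in> set V. closed_row n U x a True U)"
proof (induction n U ok V rule: closed_rows.induct)
  case (3 n U k x a V)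
  then show ?case by (simp del: closed_row.simps)
qed auto

text \<open>Bit \<open>i\<close> is set in both tags, so the pair is not skipped, and the product
  must be found with bit \<open>i\<close> set as well.\<close>

lemma check_pair_mult:
  assumes U: "tagged_ok n S U" and "check_pair n U x (tag S x) y (tag S y) (meet_empty (tag S x) (tag S y))"
    and x: "is_code n x" and i: "i < length S" "tag S x ! i" "tag S y ! i"
  shows "is_code n (code_mult n x y) \<and> tag S (code_mult n x y) ! i"
proof -
  let ?z = "code_mult n x y"
  have "\<not> meet_empty (tag S x) (tag S y)"
    using i meet_empty_nth[of "tag S x" "tag S y" i] by auto
  then have "check_code U (tag S x) (tag S y) ?z"
    using assms(2) by simp
  then have "check_mask (tag S x) (tag S y) (map_of U (fst ?z @ snd ?z))"
    by (cases ?z) (simp add: lookup_eq)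
  then obtain c m where c: "map_of U (fst ?z @ snd ?z) = Some (c, m)" "meet_le (tag S x) (tag S y) m"
    by (cases "(tag S x, tag S y, map_of U (fst ?z @ snd ?z))" rule: check_mask.cases) auto
  have "length (fst ?z) = n"
    using x by (simp add: code_mult_def is_code_iff)
  then show ?thesis
    using tagged_lookup[OF U _ c(1)] c(2) i meet_le_nth[of "tag S x" "tag S y" m i] by simp
qed

lemma tab_ok_concat: "(\<And>D. D \<in> set S \<Longrightarrow> tab_ok n D) \<Longrightarrow> tab_ok n (concat S)"
  by (auto simp: tab_ok_def)

lemma closed_tabs_mult:
  assumes S: "\<And>D. D \<in> set S \<Longrightarrow> tab_ok n D" and "closed_tabs n S" and D: "D \<in> set S"
    and x: "x \<in> codes_of D" and y: "y \<in> codes_of D"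
  shows "is_code n (code_mult n x y) \<and> code_mult n x y \<in> codes_of D"
proof -
  define U where "U = tag_codes S [] (concat S)"
  obtain i where i: "i < length S" "S ! i = D"
    using D by (auto simp: in_set_conv_nth)
  have U: "tagged_ok n S U" and mem: "\<And>w c. (w, c) \<in> set (concat S) \<Longrightarrow> (fst c @ snd c, c, tag S c) \<in> set U"
    using tag_codes_ok[of n S "[]" "concat S"] tab_ok_concat[of S n, OF S]
    by (auto simp: U_def tagged_ok_def)
  have tagged: "(fst c @ snd c, c, tag S c) \<in> set U" if "c \<in> codes_of D" for c
    using that D mem[of "lefts c" c] map_of_SomeD[of D "lefts c" c] by (auto simp: codes_of_def)
  have code: "is_code n x" "is_code n y"
    using codes_of_ok(1)[OF S[OF D]] x y by auto
  have "\<forall>(k, x, a) \<in> set U. closed_row n U x a True U"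
    using assms(2) by (simp add: closed_tabs_def closed_tagged_def U_def closed_rows_iff)
  then have "closed_row n U x (tag S x) True U"
    using tagged[OF x] by blast
  then have "check_pair n U x (tag S x) y (tag S y) (meet_empty (tag S x) (tag S y))"
    using tagged[OF y] unfolding closed_row_iff by blast
  moreover have "tag S x ! i" "tag S y ! i"
    using tag_nth[of i S n] i S[OF D] code x y by auto
  ultimately have "is_code n (code_mult n x y)" "tag S (code_mult n x y) ! i"
    using check_pair_mult[OF U _ code(1) i(1)] by auto
  then show ?thesis
    using tag_nth[of i S n] i S[OF D] by auto
qed

section \<open>Canonical cross-sections as tables that meet all classes\<close>

lemma section_of_canonical:
  assumes ok: "tab_ok n D"
    and closed: "\<And>x y. x \<in> codes_of D \<Longrightarrow> y \<in> codes_of D \<Longrightarrow>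
      is_code n (code_mult n x y) \<and> code_mult n x y \<in> codes_of D"
    and cover: "\<And>w. w \<in> set (classes n) \<Longrightarrow> \<exists>c. map_of D w = Some c"
  shows "canonical_R_cross_section n (section_of n D)"
proof -
  note code = codes_of_ok[OF ok]
  have "\<exists>!\<alpha>. \<alpha> \<in> section_of n D \<inter> C" if C: "C \<in> brauer n // green_R n" for C
  proof -
    obtain \<alpha> where \<alpha>: "\<alpha> \<in> brauer n" "C = green_R n `` {\<alpha>}"
      using C by (auto elim: quotientE)
    then obtain c where c: "is_code n c" "\<alpha> = dec n c"
      using brauer_decE by blast
    then obtain d where d: "map_of D (lefts c) = Some d"
      using cover classes_complete by blast
    have dD: "d \<in> codes_of D" "is_code n d" "lefts d = lefts c"
      using map_of_tab[OF ok d] by auto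
    have in_C: "dec n e \<in> C \<longleftrightarrow> lefts e = lefts c" if "is_code n e" for e
      using \<alpha>(2) c that green_R_dec_iff[of n c e] by auto
    show ?thesis
    proof
      show "dec n d \<in> section_of n D \<inter> C"
        using dD in_C by (auto simp: section_of_def)
      fix \<beta> assume "\<beta> \<in> section_of n D \<inter> C"
      then obtain e where "e \<in> codes_of D" "\<beta> = dec n e" "lefts e = lefts c"
        using in_C code by (auto simp: section_of_def)
      then show "\<beta> = dec n d"
        using d by (simp add: codes_of_def)
    qed
  qed
  moreover have "brauer_mult n (dec n x) (dec n y) \<in> section_of n D"
    if "x \<in> codes_of D" "y \<in> codes_of D" for x y
    using closed[OF that] code(1) that brauer_mult_dec[of n x y] by (auto simp: section_of_def)
  ultimately have "R_cross_section n (section_of n D)"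
    using code(1) dec_brauer by (auto simp: R_cross_section_def section_of_def)
  moreover have "\<forall>k. corank n (dec n x) = 2 * k \<longrightarrow>
      (\<forall>m<k. {Inr (n - 2 * k + 2 * m + 1), Inr (n - 2 * k + 2 * m + 2)} \<in> dec n x)"
    if "x \<in> codes_of D" for x
    using canonical_code_iff[of n x] code[OF that] by simp
  ultimately show ?thesis
    unfolding canonical_R_cross_section_def section_of_def by blast
qed

text \<open>Each element of \<Lambda> shares its class with an entry of the table, which is itself
  in \<Lambda>, so the two coincide. Meeting all classes thus stands in for a statement about
  generators.\<close>

lemma inside_eq_section_of:
  assumes sec: "R_cross_section n \<Lambda>" and ins: "inside n \<Lambda> D"
    and cover: "\<And>w. w \<in> set (classes n) \<Longrightarrow> \<exists>c. map_of D w = Some c"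
  shows "\<Lambda> = section_of n D"
proof
  have ok: "tab_ok n D" and mem: "\<And>w c. (w, c) \<in> set D \<Longrightarrow> dec n c \<in> \<Lambda>"
    using ins by (auto simp: inside_def)
  show "section_of n D \<subseteq> \<Lambda>"
    using mem map_of_SomeD by (fastforce simp: section_of_def codes_of_def)
  show "\<Lambda> \<subseteq> section_of n D"
  proof
    fix \<alpha> assume \<alpha>: "\<alpha> \<in> \<Lambda>"
    then obtain c where c: "is_code n c" "\<alpha> = dec n c"
      using sec brauer_decE unfolding R_cross_section_def by blast
    then obtain d where d: "map_of D (lefts c) = Some d"
      using cover classes_complete by blast
    then have "c = d"
      using section_unique[OF sec c(1) _ map_of_tab(1)[OF ok d] mem[OF map_of_SomeD[OF d]]]
        \<alpha> c(2) map_of_tab(3)[OF ok d] by simp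
    then show "\<alpha> \<in> section_of n D"
      using c(2) map_of_tab(4)[OF ok d] by (simp add: section_of_def)
  qed
qed

lemma report_covers:
  assumes "fst (report n ps (found n))" "D \<in> set (found n)"
    and "w \<in> set (classes n) \<or> w \<in> set (map (pair_class n) (corank_pairs n))"
  shows "\<exists>c. map_of D w = Some c"
  using assms unfolding report_def by (auto simp: all_cover_iff)

lemma canonical_sections_found:
  assumes rep: "fst (report n ps (found n))" and "found n \<noteq> []"
  shows "{\<Lambda>. canonical_R_cross_section n \<Lambda>} = section_of n ` set (found n)"
proof
  show "section_of n ` set (found n) \<subseteq> {\<Lambda>. canonical_R_cross_section n \<Lambda>}"
  proof clarify
    fix D assume D: "D \<in> set (found n)"
    show "canonical_R_cross_section n (section_of n D)"
    proof (rule section_of_canonical[OF found_tab_ok[OF D]])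
      show "is_code n (code_mult n x y) \<and> code_mult n x y \<in> codes_of D"
        if "x \<in> codes_of D" "y \<in> codes_of D" for x y
        using closed_tabs_mult[OF found_tab_ok _ D that] rep by (simp add: report_def)
    qed (use report_covers[OF rep D] in blast)
  qed
  show "{\<Lambda>. canonical_R_cross_section n \<Lambda>} \<subseteq> section_of n ` set (found n)"
  proof clarify
    fix \<Lambda> assume can: "canonical_R_cross_section n \<Lambda>"
    \<comment> \<open>Any table that meets the classes of corank 2 shows them to be inhabited, which
      \<open>found_inside\<close> presupposes. This is the reason for requiring
      \<open>found n\<close> to be nonempty.\<close>
    obtain E where E: "E \<in> set (found n)"
      using \<open>found n \<noteq> []\<close> by (cases "found n") auto
    have "\<exists>c. is_code n c \<and> lefts c = w" if "w \<in> set (map (pair_class n) (corank_pairs n))" for w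
      using report_covers[OF rep E, of w] that map_of_tab[OF found_tab_ok[OF E]] by blast
    then obtain D where D: "D \<in> set (found n)" "inside n \<Lambda> D"
      using found_inside[OF can] by blast
    then have "\<Lambda> = section_of n D"
      using inside_eq_section_of report_covers[OF rep D(1)] can
      unfolding canonical_R_cross_section_def by blast
    then show "\<Lambda> \<in> section_of n ` set (found n)"
      using D(1) by blast
  qed
qed

section \<open>The elements of corank 2 and their parameters\<close>

lemma at_pair_class:
  "1 \<le> a \<Longrightarrow> a \<le> n \<Longrightarrow> at (pair_class n (i, j)) a = (if a = i then j else if a = j then i else 0)"
  by (simp add: pair_class_def at_eq_nth del: upt_Suc)

text \<open>Corank 2 means exactly two nonzero entries in \<open>lefts c\<close>, and the given
  block places them at \<open>i\<close> and \<open>j\<close>. This matches the description used by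
  \<open>cs_elem\<close> with a key of the tables.\<close>

lemma lefts_eq_pair_class_iff:
  assumes c: "is_code n c" and ij: "1 \<le> i" "i < j" "j \<le> n"
  shows "lefts c = pair_class n (i, j) \<longleftrightarrow> corank n (dec n c) = 2 \<and> {Inl i, Inl j} \<in> dec n c"
proof -
  let ?A = "{a \<in> {1..n}. at (lefts c) a \<noteq> 0}"
  have len: "length (lefts c) = n" "length (pair_class n (i, j)) = n"
    using c by (simp_all add: is_code_iff pair_class_def del: upt_Suc)
  have corank: "corank n (dec n c) = card ?A"
    using corank_dec[OF c] left_degree_card[OF len(1)] by simp
  have block: "{Inl i, Inl j} \<in> dec n c \<longleftrightarrow> at (lefts c) i = j"
    using left_block_iff[OF c] ij by auto
  show ?thesis
  proof
    assume eq: "lefts c = pair_class n (i, j)"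
    have "?A = {i, j}"
      unfolding eq using ij by (auto simp: at_pair_class split: if_splits)
    then have "card ?A = 2"
      using ij by simp
    then show "corank n (dec n c) = 2 \<and> {Inl i, Inl j} \<in> dec n c"
      using corank block eq ij by (simp add: at_pair_class)
  next
    assume R: "corank n (dec n c) = 2 \<and> {Inl i, Inl j} \<in> dec n c"
    then have i: "at (lefts c) i = j" and j: "at (lefts c) j = i"
      using block at_lefts_sym(1)[OF c, of i] ij by auto
    have A: "{i, j} = ?A"
    proof (rule card_subset_eq)
      show "{i, j} \<subseteq> ?A"
        using i j ij by auto
      show "card {i, j} = card ?A"
        using R corank ij by simp
    qed simp
    have zero: "at (lefts c) a = 0" if "1 \<le> a" "a \<le> n" "a \<noteq> i" "a \<noteq> j" for a
    proof (rule ccontr)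
      assume "at (lefts c) a \<noteq> 0"
      then have "a \<in> ?A"
        using that by simp
      then show False
        unfolding A[symmetric] using that by simp
    qed
    show "lefts c = pair_class n (i, j)"
    proof (rule nth_equalityI)
      fix k assume "k < length (lefts c)"
      then have k: "1 \<le> Suc k" "Suc k \<le> n" "k < length (pair_class n (i, j))"
        using len by auto
      have "at (lefts c) (Suc k) = at (pair_class n (i, j)) (Suc k)"
        using at_pair_class[OF k(1,2), of i j] i j zero[OF k(1,2)] by auto
      then show "lefts c ! k = pair_class n (i, j) ! k"
        using \<open>k < length (lefts c)\<close> k(3) by (simp add: at_Suc)
    qed (use len in simp)
  qed
qed

lemma cs_elem_section_of:
  assumes ok: "tab_ok n D" and ij: "1 \<le> i" "i < j" "j \<le> n"
    and c: "map_of D (pair_class n (i, j)) = Some c"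
  shows "cs_elem n (section_of n D) i j = dec n c"
  unfolding cs_elem_def
proof (rule the_equality)
  show "dec n c \<in> section_of n D \<and> corank n (dec n c) = 2 \<and> {Inl i, Inl j} \<in> dec n c"
    using map_of_tab[OF ok c] lefts_eq_pair_class_iff[of n c i j] ij by (simp add: section_of_def)
  fix \<alpha> assume \<alpha>: "\<alpha> \<in> section_of n D \<and> corank n \<alpha> = 2 \<and> {Inl i, Inl j} \<in> \<alpha>"
  then obtain d where d: "d \<in> codes_of D" "\<alpha> = dec n d"
    by (auto simp: section_of_def)
  then have "lefts d = pair_class n (i, j)"
    using lefts_eq_pair_class_iff[of n d i j] codes_of_ok(1)[OF ok] ij \<alpha> by blast
  then show "\<alpha> = dec n c"
    using d c by (simp add: codes_of_def)
qed

definition perm_of :: "bool \<Rightarrow> nat \<Rightarrow> nat" where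
  "perm_of b = (if b then transpose 1 2 else id)"

lemma cs_param_section_of:
  assumes ok: "tab_ok n D" and ij: "1 \<le> i" "i < j" "j \<le> n" and l: "1 \<le> l" "2 * l \<le> n"
    and par: "param_of n l (map_of D (pair_class n (i, j))) = Some b"
  shows "cs_param n (section_of n D) i j l = perm_of b"
proof -
  obtain c where c: "map_of D (pair_class n (i, j)) = Some c"
    using par by (cases "map_of D (pair_class n (i, j))") auto
  have code: "is_code n c"
    using map_of_tab(1)[OF ok c] .
  define v where "v = at (fst c) (n - 2 * l + 2)"
  have block: "{Inl (n - 2 * l + 2), q} \<in> dec n c \<longleftrightarrow> v = q" for q
    using dec_mem_iff[OF code, of "Inl (n - 2 * l + 2)" q] l unfolding v_def by auto
  \<comment> \<open>\<open>param_of\<close> returned a value, so \<open>cs_param\<close> stops in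
    one of its first two cases and never reaches \<open>undefined\<close>.\<close>
  have "(if v = Inr (n - 2 * l) then Some False
      else if v = Inr (n - 2 * l - 1) then Some True else None) = Some b"
    using par unfolding c v_def by simp
  then show ?thesis
    unfolding cs_param_def cs_elem_section_of[OF ok ij c] block perm_of_def
    by (cases "v = Inr (n - 2 * l)"; cases "v = Inr (n - 2 * l - 1)") simp_all
qed

definition params_of :: "nat \<Rightarrow> (nat \<times> nat \<times> nat) list \<Rightarrow> pin set set set \<Rightarrow> (nat \<Rightarrow> nat) list" where
  "params_of n ps \<Lambda> = map (\<lambda>(i, j, l). cs_param n \<Lambda> i j l) ps"

definition valid_params :: "nat \<Rightarrow> (nat \<times> nat \<times> nat) list \<Rightarrow> bool" where
  "valid_params n ps \<longleftrightarrow> (\<forall>(i, j, l) \<in> set ps. 1 \<le> i \<and> i < j \<and> j \<le> n \<and> 1 \<le> l \<and> 2 * l \<le> n)"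

lemma params_of_section_of:
  assumes "tab_ok n D" "valid_params n ps" "profile n ps D = map Some bs"
  shows "params_of n ps (section_of n D) = map perm_of bs"
  using assms(2,3)
proof (induction ps arbitrary: bs)
  case (Cons p ps)
  obtain i j l where p: "p = (i, j, l)" by (cases p)
  show ?case
  proof (cases bs)
    case (Cons b bs')
    then show ?thesis
      using Cons.prems Cons.IH[of bs'] cs_param_section_of[OF assms(1), of i j l b]
      by (simp add: p params_of_def valid_params_def lookup_eq)
  qed (use Cons.prems p in simp)
qed (simp add: params_of_def)

lemma perm_of_inject: "perm_of b = perm_of c \<longleftrightarrow> b = c"
proof -
  have "transpose 1 2 \<noteq> (id :: nat \<Rightarrow> nat)"
    by (auto simp: fun_eq_iff transpose_def)
  then show ?thesis
    by (auto simp: perm_of_def)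
qed

lemma params_found:
  assumes rep: "report n ps (found n) = (True, map (map Some) B)" and "valid_params n ps"
  shows "map (params_of n ps \<circ> section_of n) (found n) = map (map perm_of) B"
proof (rule nth_equalityI)
  have prof: "map (profile n ps) (found n) = map (map Some) B"
    using rep by (simp add: report_def)
  then show len: "length (map (params_of n ps \<circ> section_of n) (found n)) = length (map (map perm_of) B)"
    using map_eq_imp_length_eq by fastforce
  fix i assume "i < length (map (params_of n ps \<circ> section_of n) (found n))"
  then have i: "i < length (found n)" "i < length B"
    using len by auto
  then have "profile n ps (found n ! i) = map Some (B ! i)"
    using arg_cong[OF prof, of "\<lambda>xs. xs ! i"] by simp
  then show "map (params_of n ps \<circ> section_of n) (found n) ! i = map (map perm_of) B ! i"
    using i params_of_section_of[OF found_tab_ok assms(2)] by simp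
qed

text \<open>Distinctness is pulled back from the evaluated list \<open>B\<close>: the tuples differ,
  hence so do the cross-sections that yield them. The image is the set of tuples in
  \<open>B\<close>, so the bijection also settles the count.\<close>

lemma bij_betw_params:
  assumes rep: "report n ps (found n) = (True, map (map Some) B)" and "valid_params n ps"
    and "distinct B" "B \<noteq> []"
  shows "bij_betw (params_of n ps) {\<Lambda>. canonical_R_cross_section n \<Lambda>} (map perm_of ` set B)"
proof -
  let ?F = "found n" and ?P = "params_of n ps \<circ> section_of n"
  have map_eq: "map ?P ?F = map (map perm_of) B"
    using params_found[OF rep assms(2)] .
  then have "?F \<noteq> []"
    using \<open>B \<noteq> []\<close> by auto
  then have sections: "{\<Lambda>. canonical_R_cross_section n \<Lambda>} = section_of n ` set ?F"
    using canonical_sections_found[of n ps] rep by simp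
  have "inj_on (map perm_of) (set B)"
    by (intro inj_onI map_injective[of perm_of]) (auto simp: inj_def perm_of_inject)
  then have "distinct (map ?P ?F)"
    unfolding map_eq using \<open>distinct B\<close> by (simp add: distinct_map)
  then have "inj_on ?P (set ?F)"
    by (simp add: distinct_map)
  moreover have "?P ` set ?F = map perm_of ` set B"
    using arg_cong[OF map_eq, of set] by simp
  ultimately show ?thesis
    unfolding sections bij_betw_def by (auto simp: image_comp dest: inj_on_imageI)
qed

section \<open>The cases up to 6\<close>

lemma S2_eq: "S2 = {perm_of False, perm_of True}"
  by (auto simp: S2_def permutes_doubleton_iff perm_of_def)

lemma cs_elem_the:
  assumes "tab_ok n D" "1 \<le> i" "i < j" "j \<le> n" "map_of D (pair_class n (i, j)) \<noteq> None"
  shows "cs_elem n (section_of n D) i j = dec n (the (map_of D (pair_class n (i, j))))"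
proof -
  obtain c where c: "map_of D (pair_class n (i, j)) = Some c"
    using assms(5) by blast
  show ?thesis
    using cs_elem_section_of[OF assms(1-4) c] unfolding c by simp
qed

lemma section_of_classes:
  assumes "fst (report n ps (found n))" "D \<in> set (found n)"
  shows "section_of n D = (\<lambda>w. dec n (the (map_of D w))) ` set (classes n)"
proof
  note ok = found_tab_ok[OF assms(2)]
  show "section_of n D \<subseteq> (\<lambda>w. dec n (the (map_of D w))) ` set (classes n)"
    using classes_complete codes_of_ok(1)[OF ok] by (force simp: section_of_def codes_of_def)
  show "(\<lambda>w. dec n (the (map_of D w))) ` set (classes n) \<subseteq> section_of n D"
    using report_covers[OF assms] map_of_tab(4)[OF ok] by (fastforce simp: section_of_def)
qed

text \<open>Positive corank occurs only for n = 2, where the two left pins are paired and the two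
  right pins remain for each other.\<close>

lemma canonical_if_small:
  assumes "n = 1 \<or> n = 2" and sec: "R_cross_section n \<Lambda>"
  shows "canonical_R_cross_section n \<Lambda>"
proof -
  have classes: "classes 1 = [[0]]" "classes 2 = [[0, 0], [2, 1]]"
    by code_simp+
  have canon: "canonical_code n c" if c: "is_code n c" for c
  proof (cases "lefts c = [2, 1]")
    case False
    then have "left_degree (lefts c) = 0"
      using classes_complete[OF c] assms(1) by (auto simp: classes left_degree_def simp del: One_nat_def)
    then show ?thesis
      by (simp add: canonical_code_def tail_starts_def)
  next
    case True
    then have n: "n = 2"
      using c by (metis is_code_iff length_lefts length_Cons list.size(3) numeral_2_eq_2)
    have "partner c (Inl 1) = Inl 2"
      using at_lefts_iff[OF c, of 1 2] n True by simp
    moreover have "partner c (Inr 1) \<in> pins 2" "partner c (Inr 1) \<noteq> Inr 1"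
      "partner c (partner c (Inr 1)) = Inr 1" "partner c (partner c (Inl 1)) = Inl 1"
      using c n pairingD[of 2 "partner c" "Inr 1"] pairingD[of 2 "partner c" "Inl 1"]
      by (simp_all add: is_code_iff del: partner.simps)
    ultimately have "partner c (Inr 1) = Inr 2"
      by (cases "partner c (Inr 1)") (auto simp: le_Suc_eq numeral_2_eq_2 simp del: partner.simps)
    then show ?thesis
      by (simp add: canonical_code_def True left_degree_def tail_starts_def n)
  qed
  have "\<forall>k. corank n \<alpha> = 2 * k \<longrightarrow>
      (\<forall>m<k. {Inr (n - 2 * k + 2 * m + 1), Inr (n - 2 * k + 2 * m + 2)} \<in> \<alpha>)" if "\<alpha> \<in> \<Lambda>" for \<alpha>
  proof -
    have "\<alpha> \<in> brauer n"
      using that sec by (auto simp: R_cross_section_def)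
    then obtain c where c: "is_code n c" "\<alpha> = dec n c"
      by (rule brauer_decE)
    show ?thesis
      using canon[OF c(1)] unfolding canonical_code_iff[OF c(1)] c(2) .
  qed
  then show ?thesis
    using sec unfolding canonical_R_cross_section_def by blast
qed

lemma single_section:
  assumes rep: "fst (report n ps (found n))" and "length (found n) = 1"
  shows "{\<Lambda>. canonical_R_cross_section n \<Lambda>} = {section_of n (hd (found n))}"
    and "hd (found n) \<in> set (found n)"
proof -
  obtain D where D: "found n = [D]"
    using assms(2) by (auto simp: length_Suc_conv)
  then have "{\<Lambda>. canonical_R_cross_section n \<Lambda>} = section_of n ` set (found n)"
    by (intro canonical_sections_found[OF rep]) simp
  then show "{\<Lambda>. canonical_R_cross_section n \<Lambda>} = {section_of n (hd (found n))}"
    unfolding D by simp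
  show "hd (found n) \<in> set (found n)"
    unfolding D by simp
qed

lemma sections_1:
  "(\<exists>!\<Lambda>. R_cross_section 1 \<Lambda>) \<and> (\<forall>\<Lambda>. R_cross_section 1 \<Lambda> \<longrightarrow> \<Lambda> = {brauer_one 1})"
proof -
  let ?D = "hd (found 1)"
  \<comment> \<open>The list of parameters is empty, as no pair satisfies
    \<open>1 \<le> i < j < n - 1\<close> for n up to 3.\<close>
  have rep: "fst (report 1 [] (found 1))" and len: "length (found 1) = 1"
    and classes: "classes 1 = [[0]]" and one: "the (map_of ?D [0]) = one_code 1"
    by code_simp+
  have "section_of 1 ?D = {brauer_one 1}"
    using section_of_classes[OF rep single_section(2)[OF rep len]]
    by (simp add: classes one dec_one_code del: One_nat_def)
  then have "R_cross_section 1 \<Lambda> \<longleftrightarrow> \<Lambda> = {brauer_one 1}" for \<Lambda>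
    using single_section(1)[OF rep len] canonical_if_small[of 1 \<Lambda>]
    by (auto simp: canonical_R_cross_section_def simp del: One_nat_def)
  then show ?thesis
    by simp
qed

lemma sections_2:
  "(\<exists>!\<Lambda>. R_cross_section 2 \<Lambda>) \<and>
   (\<forall>\<Lambda>. R_cross_section 2 \<Lambda> \<longrightarrow>
      canonical_R_cross_section 2 \<Lambda> \<and> \<Lambda> = {cs_elem 2 \<Lambda> 1 2, brauer_one 2})"
proof -
  let ?D = "hd (found 2)"
  have rep: "fst (report 2 [] (found 2))" and len: "length (found 2) = 1"
    and classes: "classes 2 = [[0, 0], [2, 1]]" and one: "the (map_of ?D [0, 0]) = one_code 2"
    and pair: "pair_class 2 (1, 2) = [2, 1]" and some: "map_of ?D [2, 1] \<noteq> None"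
    by code_simp+
  note D = single_section(2)[OF rep len]
  have elem: "cs_elem 2 (section_of 2 ?D) 1 2 = dec 2 (the (map_of ?D [2, 1]))"
    using cs_elem_the[OF found_tab_ok[OF D], of 1 2, unfolded pair] some by (simp del: One_nat_def)
  have eq: "section_of 2 ?D = {cs_elem 2 (section_of 2 ?D) 1 2, brauer_one 2}"
    unfolding elem using section_of_classes[OF rep D]
    by (simp add: classes one dec_one_code insert_commute del: One_nat_def)
  have iff: "canonical_R_cross_section 2 \<Lambda> \<longleftrightarrow> \<Lambda> = section_of 2 ?D" for \<Lambda>
    using single_section(1)[OF rep len] by auto
  moreover have "R_cross_section 2 \<Lambda> \<longleftrightarrow> canonical_R_cross_section 2 \<Lambda>" for \<Lambda>
    using canonical_if_small[of 2 \<Lambda>] canonical_R_cross_section_def[of 2 \<Lambda>] by blast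
  ultimately have "R_cross_section 2 \<Lambda> \<longleftrightarrow> \<Lambda> = section_of 2 ?D" for \<Lambda>
    by simp
  then show ?thesis
    using iff eq by simp
qed

lemma sections_3:
  "(\<exists>!\<Lambda>. canonical_R_cross_section 3 \<Lambda>) \<and>
   (\<forall>\<Lambda>. canonical_R_cross_section 3 \<Lambda> \<longrightarrow>
      \<Lambda> = {cs_elem 3 \<Lambda> 1 2, cs_elem 3 \<Lambda> 2 3, cs_elem 3 \<Lambda> 1 3, brauer_one 3} \<and>
      (\<forall>\<epsilon> \<in> {cs_elem 3 \<Lambda> 1 2, cs_elem 3 \<Lambda> 2 3, cs_elem 3 \<Lambda> 1 3, brauer_one 3}.
         brauer_mult 3 \<epsilon> \<epsilon> = \<epsilon>))"
proof -
  let ?D = "hd (found 3)"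
  let ?c = "\<lambda>w. the (map_of ?D w)"
  have rep: "fst (report 3 [] (found 3))" and len: "length (found 3) = 1"
    and classes: "set (classes 3) = {[2, 1, 0], [0, 3, 2], [3, 0, 1], [0, 0, 0]}"
    and one: "?c [0, 0, 0] = one_code 3"
    and pair: "pair_class 3 (1, 2) = [2, 1, 0]" "pair_class 3 (2, 3) = [0, 3, 2]"
      "pair_class 3 (1, 3) = [3, 0, 1]"
    and some: "map_of ?D [2, 1, 0] \<noteq> None" "map_of ?D [0, 3, 2] \<noteq> None" "map_of ?D [3, 0, 1] \<noteq> None"
    and idem: "list_all (\<lambda>w. is_code 3 (?c w) \<and> code_mult 3 (?c w) (?c w) = ?c w) (classes 3)"
    by code_simp+
  note D = single_section(2)[OF rep len]
  let ?\<Lambda> = "section_of 3 ?D"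
  have elem: "cs_elem 3 ?\<Lambda> 1 2 = dec 3 (?c [2, 1, 0])" "cs_elem 3 ?\<Lambda> 2 3 = dec 3 (?c [0, 3, 2])"
    "cs_elem 3 ?\<Lambda> 1 3 = dec 3 (?c [3, 0, 1])"
    using cs_elem_the[OF found_tab_ok[OF D], of 1 2, unfolded pair]
      cs_elem_the[OF found_tab_ok[OF D], of 2 3, unfolded pair]
      cs_elem_the[OF found_tab_ok[OF D], of 1 3, unfolded pair] some
    by (simp_all del: One_nat_def)
  have eq: "?\<Lambda> = {cs_elem 3 ?\<Lambda> 1 2, cs_elem 3 ?\<Lambda> 2 3, cs_elem 3 ?\<Lambda> 1 3, brauer_one 3}"
    unfolding elem using section_of_classes[OF rep D] by (simp add: classes one dec_one_code del: One_nat_def)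
  have "brauer_mult 3 \<epsilon> \<epsilon> = \<epsilon>" if "\<epsilon> \<in> ?\<Lambda>" for \<epsilon>
  proof -
    obtain w where "w \<in> set (classes 3)" "\<epsilon> = dec 3 (?c w)"
      using \<open>\<epsilon> \<in> ?\<Lambda>\<close> section_of_classes[OF rep D] by auto
    \<comment> \<open>\<open>idem\<close> evaluates two facts: the element equals its computed
      square, and it is a code. Together they give the premise on the product in
      \<open>brauer_mult_dec\<close>.\<close>
    then show ?thesis
      using idem brauer_mult_dec[of 3 "?c w" "?c w"] by (simp add: list_all_iff)
  qed
  moreover have "canonical_R_cross_section 3 \<Lambda> \<longleftrightarrow> \<Lambda> = ?\<Lambda>" for \<Lambda>
    using single_section(1)[OF rep len] by auto
  ultimately show ?thesis
    using eq by (metis (no_types, lifting))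
qed

lemma report_4: "report 4 [(1, 2, 1)] (found 4) = (True, map (map Some) [[False], [True]])"
  by code_simp

lemma report_5: "report 5 [(1, 2, 1), (2, 3, 1), (1, 3, 1)] (found 5) = (True, map (map Some)
   [[False, False, False], [False, True, False], [False, False, True], [False, True, True],
    [True, False, False], [True, True, False], [True, False, True], [True, True, True]])"
  by code_simp

text \<open>For n = 6 the pairs (1,4), (2,4), (3,4) carry one parameter each as well. All 16 values
  of the four parameters listed here occur once each, so the remaining three are functions of
  them.\<close>

lemma report_6: "report 6 [(1, 2, 1), (1, 2, 2), (2, 3, 1), (1, 3, 1)] (found 6) = (True, map (map Some)
   [[False, False, False, False], [False, False, True, False], [False, False, False, True],
    [False, False, True, True], [True, False, False, False], [True, False, True, False],
    [True, False, False, True], [True, False, True, True], [False, True, False, False],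
    [False, True, True, False], [False, True, False, True], [False, True, True, True],
    [True, True, False, False], [True, True, True, False], [True, True, False, True],
    [True, True, True, True]])"
  by code_simp

lemma sections_4:
  "\<exists>\<Lambda>\<^sub>1 \<Lambda>\<^sub>2. \<Lambda>\<^sub>1 \<noteq> \<Lambda>\<^sub>2 \<and> {\<Lambda>. canonical_R_cross_section 4 \<Lambda>} = {\<Lambda>\<^sub>1, \<Lambda>\<^sub>2} \<and>
     cs_param 4 \<Lambda>\<^sub>1 1 2 1 = id \<and> cs_param 4 \<Lambda>\<^sub>2 1 2 1 = transpose 1 2"
proof -
  have "bij_betw (params_of 4 [(1, 2, 1)]) {\<Lambda>. canonical_R_cross_section 4 \<Lambda>}
      {[perm_of False], [perm_of True]}"
    using bij_betw_params[OF report_4] by (simp add: valid_params_def)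
  \<comment> \<open>The preimages of the two lists under the bijection; injectivity leaves no third
    cross-section.\<close>
  then obtain \<Lambda>1 \<Lambda>2 where \<Lambda>: "\<Lambda>1 \<in> {\<Lambda>. canonical_R_cross_section 4 \<Lambda>}" "params_of 4 [(1, 2, 1)] \<Lambda>1 = [perm_of False]"
    "\<Lambda>2 \<in> {\<Lambda>. canonical_R_cross_section 4 \<Lambda>}" "params_of 4 [(1, 2, 1)] \<Lambda>2 = [perm_of True]"
    "\<And>\<Lambda>. canonical_R_cross_section 4 \<Lambda> \<Longrightarrow> \<Lambda> = \<Lambda>1 \<or> \<Lambda> = \<Lambda>2"
    unfolding bij_betw_def inj_on_def by (smt (verit) imageE imageI insertI1 insertI2 insertE mem_Collect_eq singletonD)
  have params: "cs_param 4 \<Lambda>1 1 2 1 = perm_of False" "cs_param 4 \<Lambda>2 1 2 1 = perm_of True"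
    using \<Lambda>(2,4) by (simp_all add: params_of_def)
  moreover have "\<Lambda>1 \<noteq> \<Lambda>2"
    using params perm_of_inject by auto
  moreover have "{\<Lambda>. canonical_R_cross_section 4 \<Lambda>} = {\<Lambda>1, \<Lambda>2}"
    using \<Lambda>(1,3,5) by blast
  ultimately show ?thesis
    unfolding perm_of_def by auto
qed

lemma sections_5:
  "bij_betw (\<lambda>\<Lambda>. (cs_param 5 \<Lambda> 1 2 1, cs_param 5 \<Lambda> 2 3 1, cs_param 5 \<Lambda> 1 3 1))
     {\<Lambda>. canonical_R_cross_section 5 \<Lambda>} (S2 \<times> S2 \<times> S2)"
proof -
  let ?tuple = "\<lambda>xs :: (nat \<Rightarrow> nat) list. (xs ! 0, xs ! 1, xs ! 2)"
  note bij = bij_betw_params[OF report_5]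
  have "bij_betw (params_of 5 [(1, 2, 1), (2, 3, 1), (1, 3, 1)]) {\<Lambda>. canonical_R_cross_section 5 \<Lambda>}
      {[a, b, c] |a b c. a \<in> S2 \<and> b \<in> S2 \<and> c \<in> S2}"
  proof -
    have "{[a, b, c] |a b c. a \<in> S2 \<and> b \<in> S2 \<and> c \<in> S2} = map perm_of ` set
       [[False, False, False], [False, True, False], [False, False, True], [False, True, True],
        [True, False, False], [True, True, False], [True, False, True], [True, True, True]]"
      unfolding S2_eq by auto
    then show ?thesis
      using bij by (simp add: valid_params_def)
  qed
  moreover have "bij_betw ?tuple {[a, b, c] |a b c. a \<in> S2 \<and> b \<in> S2 \<and> c \<in> S2} (S2 \<times> S2 \<times> S2)"
    by (rule bij_betw_byWitness[where f' = "\<lambda>(a, b, c). [a, b, c]"]) auto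
  ultimately show ?thesis
    using bij_betw_trans by (fastforce simp: params_of_def comp_def)
qed

lemma sections_6:
  "bij_betw
     (\<lambda>\<Lambda>. (cs_param 6 \<Lambda> 1 2 1, cs_param 6 \<Lambda> 1 2 2, cs_param 6 \<Lambda> 2 3 1, cs_param 6 \<Lambda> 1 3 1))
     {\<Lambda>. canonical_R_cross_section 6 \<Lambda>} (S2 \<times> S2 \<times> S2 \<times> S2)"
proof -
  let ?tuple = "\<lambda>xs :: (nat \<Rightarrow> nat) list. (xs ! 0, xs ! 1, xs ! 2, xs ! 3)"
  note bij = bij_betw_params[OF report_6]
  have "bij_betw (params_of 6 [(1, 2, 1), (1, 2, 2), (2, 3, 1), (1, 3, 1)])
      {\<Lambda>. canonical_R_cross_section 6 \<Lambda>}
      {[a, b, c, d] |a b c d. a \<in> S2 \<and> b \<in> S2 \<and> c \<in> S2 \<and> d \<in> S2}"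
  proof -
    have "{[a, b, c, d] |a b c d. a \<in> S2 \<and> b \<in> S2 \<and> c \<in> S2 \<and> d \<in> S2} = map perm_of ` set
       [[False, False, False, False], [False, False, True, False], [False, False, False, True],
        [False, False, True, True], [True, False, False, False], [True, False, True, False],
        [True, False, False, True], [True, False, True, True], [False, True, False, False],
        [False, True, True, False], [False, True, False, True], [False, True, True, True],
        [True, True, False, False], [True, True, True, False], [True, True, False, True],
        [True, True, True, True]]"
      unfolding S2_eq by auto
    then show ?thesis
      using bij by (simp add: valid_params_def)
  qed
  moreover have "bij_betw ?tuple {[a, b, c, d] |a b c d. a \<in> S2 \<and> b \<in> S2 \<and> c \<in> S2 \<and> d \<in> S2}
      (S2 \<times> S2 \<times> S2 \<times> S2)"
    by (rule bij_betw_byWitness[where f' = "\<lambda>(a, b, c, d). [a, b, c, d]"]) auto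
  ultimately show ?thesis
    using bij_betw_trans by (fastforce simp: params_of_def comp_def)
qed

lemma card_S2: "card S2 = 2"
  by (simp add: S2_eq perm_of_inject)

theorem proposition9:
  shows
    "((\<exists>!\<Lambda>. R_cross_section 1 \<Lambda>) \<and>
      (\<forall>\<Lambda>. R_cross_section 1 \<Lambda> \<longrightarrow> \<Lambda> = {brauer_one 1})) \<and>

     ((\<exists>!\<Lambda>. R_cross_section 2 \<Lambda>) \<and>
      (\<forall>\<Lambda>. R_cross_section 2 \<Lambda> \<longrightarrow>
         canonical_R_cross_section 2 \<Lambda> \<and> \<Lambda> = {cs_elem 2 \<Lambda> 1 2, brauer_one 2})) \<and>

     ((\<exists>!\<Lambda>. canonical_R_cross_section 3 \<Lambda>) \<and>
      (\<forall>\<Lambda>. canonical_R_cross_section 3 \<Lambda> \<longrightarrow>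
         \<Lambda> = {cs_elem 3 \<Lambda> 1 2, cs_elem 3 \<Lambda> 2 3, cs_elem 3 \<Lambda> 1 3, brauer_one 3} \<and>
         (\<forall>\<epsilon> \<in> {cs_elem 3 \<Lambda> 1 2, cs_elem 3 \<Lambda> 2 3, cs_elem 3 \<Lambda> 1 3, brauer_one 3}.
            brauer_mult 3 \<epsilon> \<epsilon> = \<epsilon>))) \<and>

     (\<exists>\<Lambda>\<^sub>1 \<Lambda>\<^sub>2. \<Lambda>\<^sub>1 \<noteq> \<Lambda>\<^sub>2 \<and> {\<Lambda>. canonical_R_cross_section 4 \<Lambda>} = {\<Lambda>\<^sub>1, \<Lambda>\<^sub>2} \<and>
        cs_param 4 \<Lambda>\<^sub>1 1 2 1 = id \<and> cs_param 4 \<Lambda>\<^sub>2 1 2 1 = transpose 1 2) \<and>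

     (card {\<Lambda>. canonical_R_cross_section 5 \<Lambda>} = 8 \<and>
      bij_betw (\<lambda>\<Lambda>. (cs_param 5 \<Lambda> 1 2 1, cs_param 5 \<Lambda> 2 3 1, cs_param 5 \<Lambda> 1 3 1))
        {\<Lambda>. canonical_R_cross_section 5 \<Lambda>} (S2 \<times> S2 \<times> S2)) \<and>

     (card {\<Lambda>. canonical_R_cross_section 6 \<Lambda>} = 16 \<and>
      bij_betw
        (\<lambda>\<Lambda>. (cs_param 6 \<Lambda> 1 2 1, cs_param 6 \<Lambda> 1 2 2, cs_param 6 \<Lambda> 2 3 1, cs_param 6 \<Lambda> 1 3 1))
        {\<Lambda>. canonical_R_cross_section 6 \<Lambda>} (S2 \<times> S2 \<times> S2 \<times> S2))"
proof -
  have card_5: "card {\<Lambda>. canonical_R_cross_section 5 \<Lambda>} = 8"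
    using bij_betw_same_card[OF sections_5] by (simp add: card_cartesian_product card_S2)
  have card_6: "card {\<Lambda>. canonical_R_cross_section 6 \<Lambda>} = 16"
    using bij_betw_same_card[OF sections_6] by (simp add: card_cartesian_product card_S2)
  show ?thesis
    by (rule conjI[OF sections_1 conjI[OF sections_2 conjI[OF sections_3 conjI[OF sections_4
      conjI[OF conjI[OF card_5 sections_5] conjI[OF card_6 sections_6]]]]]])
qed

end
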